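(* Let $m\geq n\geq1$ be integers, $k\in\mathbb{C}$, $\alpha_1=k+n$, $\alpha_2=k+m$, and let $\mathcal{W}^k(\mathfrak{gl}(m+n),f)\subset V^\kappa(\mathfrak b)$ be the $W$-algebra of the context, with $f$ of type $(2^n,1^{m-n})$. Set $$W^{(1)}_{i,j}=\sum_{\substack{1\leq h,l\leq m+n\\ \mathrm{row}(h)=i,\ \mathrm{row}(l)=j\\ \mathrm{col}(h)=\mathrm{col}(l)}}e_{h,l}[-1]\quad\text{for }1\leq i\leq m-n,\ 1\leq j\leq m,\ \text{ or } m-n<i,j\leq m,$$ $$W^{(2)}_{i,j}=e_{\hat i,j}[-1]-\alpha_2e_{i,j}[-2]+\sum_{m-n<u\leq m}e_{u,j}[-1]e_{\hat i,\hat u}[-1]-\sum_{1\leq u\leq m-n}e_{u,j}[-1]e_{i,u}[-1]\quad\text{for }m-n<i\leq m,\ 1\leq j\leq m.$$ Then the elements $$\{W^{(1)}_{i,j}\mid 1\leq i\leq m-n,\ 1\leq j\leq m\ \text{ or }\ m-n<i,j\leq m\}\ \cup\ \{W^{(2)}_{i,j}\mid m-n<i\leq m,\ 1\leq j\leq m\}$$ are strong generators of the vertex algebra $\mathcal{W}^k(\mathfrak{gl}(m+n),f)$.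
   Context: Let $e_{i,j}$ ($1\leq i,j\leq m+n$) be the matrix units of $\mathfrak{gl}(m+n)$. Put $\mathrm{col}(i)=1,\ \mathrm{row}(i)=i$ if $i\leq m$, and $\mathrm{col}(i)=2,\ \mathrm{row}(i)=i-n$ if $i>m$. For $m-n<i\leq m$ put $\hat i=i+n$; for $m<j\leq m+n$ put $\tilde j=j-n$. The nilpotent element is $f=\sum_{m-n<j\leq m}e_{\hat j,j}$. Let $\mathfrak{b}=\bigoplus_{\mathrm{col}(i)\geq\mathrm{col}(j)}\mathbb{C}e_{i,j}$, with bilinear form $\kappa(e_{i,j},e_{p,q})=\alpha_1\delta_{i,q}\delta_{p,j}+\delta_{i,j}\delta_{p,q}$ if $1\leq i,j,p,q\leq m$; $=\alpha_2\delta_{i,q}\delta_{p,j}+\delta_{i,j}\delta_{p,q}$ if $m<i,j,p,q\leq m+n$; $=0$ otherwise. Let $\mathfrak{a}=\mathfrak{b}\oplus\bigoplus_{\mathrm{col}(i)>\mathrm{col}(j)}\mathbb{C}\psi_{i,j}$ be the Lie superalgebra with $\mathfrak b$ even, $\psi_{i,j}$ odd, $[e_{i,j},\psi_{p,q}]=\delta_{j,p}\psi_{i,q}-\delta_{i,q}\psi_{p,j}$, $[\psi_{i,j},\psi_{p,q}]=0$ (symbols $\psi$ with out-of-range indices are $0$), and extend $\kappa$ to $\tilde\kappa$ on $\mathfrak a$ by zero on all pairs involving a $\psi$. $V^\kappa(\mathfrak b)\subset V^{\tilde\kappa}(\mathfrak a)$ are the universal affine vertex (super)algebras, identified with $U(t^{-1}\mathfrak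 b[t^{-1}])$ and $U(t^{-1}\mathfrak a[t^{-1}])$; $u[-s]$ denotes $ut^{-s}$; products of such elements denote $(-1)$-products; $\partial$ is the translation operator; the OPE is $u(z)v(w)\sim\frac{[u,v](w)}{z-w}+\frac{\tilde\kappa(u,v)}{(z-w)^2}$. Let $d_0\colon V^\kappa(\mathfrak b)\to V^{\tilde\kappa}(\mathfrak a)$ be the odd derivation (with respect to all $n$-th products) with $d_0|0\rangle=0$, $[d_0,\partial]=0$ and $$d_0(e_{i,j}[-1])=\sum_{\mathrm{col}(i)>\mathrm{col}(r)\geq\mathrm{col}(j)}e_{r,j}[-1]\psi_{i,r}[-1]-\sum_{\mathrm{col}(j)<\mathrm{col}(r)\leq\mathrm{col}(i)}\psi_{r,j}[-1]e_{i,r}[-1]+\delta(\mathrm{col}(i)>\mathrm{col}(j))\alpha_2\psi_{i,j}[-2]+\psi_{\hat i,j}[-1]-\psi_{i,\tilde j}[-1],$$ where terms with $\hat i$ or $\tilde j$ not defined are $0$ and $\delta(P)$ is $1$ if $P$ holds and $0$ otherwise. The $W$-algebra is the vertex subalgebra $\mathcal{W}^k(\mathfrak{gl}(m+n),f)=\{y\in V^\kappa(\mathfrak b)\mid d_0(y)=0\}$. A vertex algebra $V$ is strongly generated by a subset $\{v^a\}\subset V$ if $V$ is spanned by the vectors $v^{a_1}_{(-n_1)}\cdots v^{a_r}_{(-n_r)}|0\rangle$ with $r\geq0$ and all $n_i\geq1$. *)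

theory Defs
  imports Complex_Main "HOL-Library.Poly_Mapping"
begin

section \<open>Vertex superalgebras\<close>

text \<open>
  The underlying complex vector space is the whole type \<open>'v\<close> with scalar multiplication
  \<open>smult\<close>; \<open>vpart False\<close> and \<open>vpart True\<close> are its even and odd parts, and
  \<open>nprod V a n b\<close> is the \<open>n\<close>-th product \<open>a\<^sub>(\<^sub>n\<^sub>) b\<close>.
\<close>

record 'v vertex_data =
  smult :: "complex \<Rightarrow> 'v \<Rightarrow> 'v"
  vpart :: "bool \<Rightarrow> 'v set"
  vac :: 'v
  transl :: "'v \<Rightarrow> 'v"
  nprod :: "'v \<Rightarrow> int \<Rightarrow> 'v \<Rightarrow> 'v"

definition koszul_sign :: "bool \<Rightarrow> bool \<Rightarrow> complex" where
  "koszul_sign p q = (if p \<and> q then -1 else 1)"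

text \<open>
  Each \<open>Sum_any\<close> in the Borcherds identity has finitely many nonzero terms by axiom
  \<open>field\<close>.
\<close>

locale vertex_superalgebra =
  fixes V :: "('v::ab_group_add) vertex_data" (structure)
  assumes vs: "vector_space (smult V)"
    and subspace_part: "\<And>p. module.subspace (smult V) (vpart V p)"
    and direct: "vpart V False \<inter> vpart V True = {0}"
    and decomp: "\<And>v. \<exists>v0\<in>vpart V False. \<exists>v1\<in>vpart V True. v = v0 + v1"
    and vac_even: "vac V \<in> vpart V False"
    and transl_even: "\<And>p a. a \<in> vpart V p \<Longrightarrow> transl V a \<in> vpart V p"
    and nprod_parity: "\<And>p q a b n. a \<in> vpart V p \<Longrightarrow> b \<in> vpart V q \<Longrightarrow>
          nprod V a n b \<in> vpart V (p \<noteq> q)"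
    and transl_linear: "Vector_Spaces.linear (smult V) (smult V) (transl V)"
    and nprod_linear_left: "\<And>n b. Vector_Spaces.linear (smult V) (smult V) (\<lambda>a. nprod V a n b)"
    and nprod_linear_right: "\<And>a n. Vector_Spaces.linear (smult V) (smult V) (nprod V a n)"
    and field: "\<And>a b. \<exists>N. \<forall>n\<ge>N. nprod V a n b = 0"
    and vac_left: "\<And>n a. nprod V (vac V) n a = (if n = -1 then a else 0)"
    and vac_right: "\<And>n a. n \<ge> 0 \<Longrightarrow> nprod V a n (vac V) = 0"
    and creation: "\<And>a. nprod V a (-1) (vac V) = a"
    and transl_nprod: "\<And>a n b. nprod V (transl V a) n b = smult V (- of_int n) (nprod V a (n - 1) b)"
    and transl_derivation: "\<And>a n b.
          transl V (nprod V a n b) = nprod V (transl V a) n b + nprod V a n (transl V b)"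
    and borcherds: "\<And>p q a b c m n k. a \<in> vpart V p \<Longrightarrow> b \<in> vpart V q \<Longrightarrow>
          Sum_any (\<lambda>j. smult V (of_int m gchoose j) (nprod V (nprod V a (n + int j) b) (m + k - int j) c))
        = Sum_any (\<lambda>j. smult V ((-1) ^ j * (of_int n gchoose j))
            (nprod V a (m + n - int j) (nprod V b (k + int j) c)
             - smult V ((-1) powi n * koszul_sign p q)
                 (nprod V b (n + k - int j) (nprod V a (m + int j) c))))"

text \<open>
  \<open>strongly_generates V W S\<close>: the vertex subalgebra \<open>W\<close> of \<open>V\<close> is strongly generated
  by \<open>S \<subseteq> W\<close>. A list \<open>[(a\<^sub>1, n\<^sub>1), \<dots>, (a\<^sub>r, n\<^sub>r)]\<close> stands for
  \<open>a\<^sub>1\<^sub>(\<^sub>-\<^sub>n\<^sub>1\<^sub>) \<dots> a\<^sub>r\<^sub>(\<^sub>-\<^sub>n\<^sub>r\<^sub>) |0\<rangle>\<close>.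
\<close>

definition creation_vec :: "'v vertex_data \<Rightarrow> ('v \<times> nat) list \<Rightarrow> 'v" where
  "creation_vec V l = foldr (\<lambda>(a, n) v. nprod V a (- int n) v) l (vac V)"

definition strongly_generates :: "('v::ab_group_add) vertex_data \<Rightarrow> 'v set \<Rightarrow> 'v set \<Rightarrow> bool" where
  "strongly_generates V W S \<longleftrightarrow> S \<subseteq> W \<and>
     W = module.span (smult V) {creation_vec V l |l. \<forall>(a, n)\<in>set l. a \<in> S \<and> 1 \<le> n}"


section \<open>Universal affine vertex superalgebras\<close>

text \<open>
  A Lie superalgebra \<open>\<g>\<close> is given by a homogeneous basis \<open>B\<close>, the parity \<open>par\<close> of the basis
  elements (\<open>True\<close> means odd), the brackets \<open>br x y\<close> of basis elements as formal linear
  combinations of basis elements, and a bilinear form \<open>\<kappa>\<close> by its values on basis elements.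

  A word \<open>[(x\<^sub>1, s\<^sub>1), \<dots>, (x\<^sub>r, s\<^sub>r)]\<close> with \<open>x\<^sub>i \<in> B\<close>, \<open>s\<^sub>i \<ge> 1\<close> stands for the product
  \<open>x\<^sub>1[-s\<^sub>1] \<dots> x\<^sub>r[-s\<^sub>r]\<close>; the free algebra on the \<open>x[-s]\<close> consists of the formal linear
  combinations of words, and \<open>env_ideal\<close> is the two-sided ideal generated by
  \<open>x[-s] y[-t] - (-1)^(|x||y|) y[-t] x[-s] - [x,y][-s-t]\<close>, so that the quotient is
  \<open>U(t\<^sup>-\<^sup>1\<g>[t\<^sup>-\<^sup>1])\<close>.
\<close>

definition lin_ext :: "(complex \<Rightarrow> 'w \<Rightarrow> 'w) \<Rightarrow> ('x \<Rightarrow> 'w::comm_monoid_add) \<Rightarrow> ('x \<Rightarrow>\<^sub>0 complex) \<Rightarrow> 'w" where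
  "lin_ext s f p = (\<Sum>x\<in>Poly_Mapping.keys p. s (Poly_Mapping.lookup p x) (f x))"

definition pm_scale :: "complex \<Rightarrow> ('x \<Rightarrow>\<^sub>0 complex) \<Rightarrow> ('x \<Rightarrow>\<^sub>0 complex)" where
  "pm_scale c p = Poly_Mapping.map ((*) c) p"

definition neg_words :: "'x set \<Rightarrow> ('x \<times> nat) list set" where
  "neg_words B = {w. \<forall>(x, s)\<in>set w. x \<in> B \<and> 1 \<le> s}"

definition env_relation ::
  "('x \<Rightarrow> bool) \<Rightarrow> ('x \<Rightarrow> 'x \<Rightarrow> ('x \<Rightarrow>\<^sub>0 complex)) \<Rightarrow> ('x \<times> nat) list \<Rightarrow> 'x \<times> nat \<Rightarrow> 'x \<times> nat
    \<Rightarrow> ('x \<times> nat) list \<Rightarrow> (('x \<times> nat) list \<Rightarrow>\<^sub>0 complex)" where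
  "env_relation par br u a b w =
     (case a of (x, s) \<Rightarrow> case b of (y, t) \<Rightarrow>
        Poly_Mapping.single (u @ [(x, s), (y, t)] @ w) 1
        - Poly_Mapping.single (u @ [(y, t), (x, s)] @ w) (koszul_sign (par x) (par y))
        - lin_ext pm_scale (\<lambda>z. Poly_Mapping.single (u @ [(z, s + t)] @ w) 1) (br x y))"

definition env_ideal ::
  "'x set \<Rightarrow> ('x \<Rightarrow> bool) \<Rightarrow> ('x \<Rightarrow> 'x \<Rightarrow> ('x \<Rightarrow>\<^sub>0 complex)) \<Rightarrow> (('x \<times> nat) list \<Rightarrow>\<^sub>0 complex) set" where
  "env_ideal B par br = module.span pm_scale
     {env_relation par br u a b w |u a b w. u @ [a, b] @ w \<in> neg_words B}"

definition word_vec :: "'v vertex_data \<Rightarrow> ('x \<Rightarrow> 'v) \<Rightarrow> ('x \<times> nat) list \<Rightarrow> 'v" where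
  "word_vec V \<iota> w = creation_vec V (map (\<lambda>(x, s). (\<iota> x, s)) w)"

text \<open>
  \<open>V\<close>, together with the states \<open>\<iota> x = x[-1]\<close> for \<open>x \<in> B\<close>, is the universal affine vertex
  superalgebra \<open>V\<^sup>\<kappa>(\<g>)\<close>: the products \<open>\<iota> x\<^sub>(\<^sub>n\<^sub>) \<iota> y\<close>, \<open>n \<ge> 0\<close>, are those prescribed by the OPE
  \<open>x(z) y(w) \<sim> [x,y](w)/(z-w) + \<kappa>(x,y)/(z-w)^2\<close>, and the map
  \<open>x\<^sub>1[-s\<^sub>1] \<dots> x\<^sub>r[-s\<^sub>r] \<mapsto> x\<^sub>1\<^sub>(\<^sub>-\<^sub>s\<^sub>1\<^sub>) \<dots> x\<^sub>r\<^sub>(\<^sub>-\<^sub>s\<^sub>r\<^sub>) |0\<rangle>\<close> from the free algebra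
  to \<open>V\<close> is onto with kernel \<open>env_ideal\<close>, i.e. it identifies \<open>U(t\<^sup>-\<^sup>1\<g>[t\<^sup>-\<^sup>1])\<close> with \<open>V\<close>.
\<close>

definition universal_affine ::
  "('v::ab_group_add) vertex_data \<Rightarrow> 'x set \<Rightarrow> ('x \<Rightarrow> bool) \<Rightarrow> ('x \<Rightarrow> 'x \<Rightarrow> ('x \<Rightarrow>\<^sub>0 complex))
    \<Rightarrow> ('x \<Rightarrow> 'x \<Rightarrow> complex) \<Rightarrow> ('x \<Rightarrow> 'v) \<Rightarrow> bool" where
  "universal_affine V B par br \<kappa> \<iota> \<longleftrightarrow>
     vertex_superalgebra V \<and>
     (\<forall>x\<in>B. \<iota> x \<in> vpart V (par x)) \<and>
     (\<forall>x\<in>B. \<forall>y\<in>B.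
        nprod V (\<iota> x) 0 (\<iota> y) = lin_ext (smult V) \<iota> (br x y) \<and>
        nprod V (\<iota> x) 1 (\<iota> y) = smult V (\<kappa> x y) (vac V) \<and>
        (\<forall>n\<ge>2. nprod V (\<iota> x) n (\<iota> y) = 0)) \<and>
     (\<forall>v. \<exists>p. Poly_Mapping.keys p \<subseteq> neg_words B \<and> v = lin_ext (smult V) (word_vec V \<iota>) p) \<and>
     (\<forall>p. Poly_Mapping.keys p \<subseteq> neg_words B \<longrightarrow>
        (lin_ext (smult V) (word_vec V \<iota>) p = 0 \<longleftrightarrow> p \<in> env_ideal B par br))"


section \<open>The Lie superalgebra \<open>\<a>\<close>\<close>

text \<open>Throughout, indices run over \<open>{1..m+n}\<close>, with \<open>1 \<le> n \<le> m\<close>.\<close>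

datatype gen = E nat nat | Psi nat nat

definition col :: "nat \<Rightarrow> nat \<Rightarrow> nat" where
  "col m i = (if i \<le> m then 1 else 2)"

definition row :: "nat \<Rightarrow> nat \<Rightarrow> nat \<Rightarrow> nat" where
  "row m n i = (if i \<le> m then i else i - n)"

definition b_basis :: "nat \<Rightarrow> nat \<Rightarrow> gen set" where
  "b_basis m n = {E i j |i j. i \<in> {1..m+n} \<and> j \<in> {1..m+n} \<and> col m i \<ge> col m j}"

definition a_basis :: "nat \<Rightarrow> nat \<Rightarrow> gen set" where
  "a_basis m n = b_basis m n \<union>
     {Psi i j |i j. i \<in> {1..m+n} \<and> j \<in> {1..m+n} \<and> col m i > col m j}"

fun gen_odd :: "gen \<Rightarrow> bool" where
  "gen_odd (E i j) = False"
| "gen_odd (Psi i j) = True"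

text \<open>
  On \<open>a_basis\<close> every symbol with nonzero coefficient on the right-hand sides is again in range,
  so that no convention for out-of-range symbols is needed.
\<close>

fun a_bracket :: "gen \<Rightarrow> gen \<Rightarrow> (gen \<Rightarrow>\<^sub>0 complex)" where
  "a_bracket (E i j) (E p q) =
     Poly_Mapping.single (E i q) (of_bool (j = p)) - Poly_Mapping.single (E p j) (of_bool (i = q))"
| "a_bracket (E i j) (Psi p q) =
     Poly_Mapping.single (Psi i q) (of_bool (j = p)) - Poly_Mapping.single (Psi p j) (of_bool (i = q))"
| "a_bracket (Psi p q) (E i j) =
     - (Poly_Mapping.single (Psi i q) (of_bool (j = p)) - Poly_Mapping.single (Psi p j) (of_bool (i = q)))"
| "a_bracket (Psi i j) (Psi p q) = 0"

fun kappa :: "nat \<Rightarrow> nat \<Rightarrow> complex \<Rightarrow> complex \<Rightarrow> gen \<Rightarrow> gen \<Rightarrow> complex" where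
  "kappa m n \<alpha>1 \<alpha>2 (E i j) (E p q) =
     (if {i, j, p, q} \<subseteq> {1..m} then \<alpha>1 * of_bool (i = q \<and> p = j) + of_bool (i = j \<and> p = q)
      else if {i, j, p, q} \<subseteq> {m<..m+n} then \<alpha>2 * of_bool (i = q \<and> p = j) + of_bool (i = j \<and> p = q)
      else 0)"
| "kappa m n \<alpha>1 \<alpha>2 (E i j) (Psi p q) = 0"
| "kappa m n \<alpha>1 \<alpha>2 (Psi i j) (E p q) = 0"
| "kappa m n \<alpha>1 \<alpha>2 (Psi i j) (Psi p q) = 0"


section \<open>The W-algebra\<close>

text \<open>\<open>V\<^sup>\<kappa>(\<b>)\<close>, i.e. \<open>U(t\<^sup>-\<^sup>1\<b>[t\<^sup>-\<^sup>1])\<close>, as a subspace of \<open>V\<^sup>\<kappa>(\<a>)\<close>.\<close>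

definition Vb :: "nat \<Rightarrow> nat \<Rightarrow> ('v::ab_group_add) vertex_data \<Rightarrow> (gen \<Rightarrow> 'v) \<Rightarrow> 'v set" where
  "Vb m n V \<iota> = module.span (smult V) (word_vec V \<iota> ` neg_words (b_basis m n))"

text \<open>The state \<open>x[-s]\<close>.\<close>

definition aff :: "'v vertex_data \<Rightarrow> (gen \<Rightarrow> 'v) \<Rightarrow> gen \<Rightarrow> nat \<Rightarrow> 'v" where
  "aff V \<iota> x s = nprod V (\<iota> x) (- int s) (vac V)"

text \<open>
  The right-hand side of the formula for \<open>d\<^sub>0(e\<^sub>i\<^sub>,\<^sub>j[-1])\<close>; \<open>i + n\<close> and \<open>j - n\<close> are
  \<open>\<hat>i\<close> (defined for \<open>m - n < i \<le> m\<close>) and \<open>\<tilde>j\<close> (defined for \<open>m < j \<le> m + n\<close>).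
\<close>

definition d0_gen ::
  "nat \<Rightarrow> nat \<Rightarrow> complex \<Rightarrow> ('v::ab_group_add) vertex_data \<Rightarrow> (gen \<Rightarrow> 'v) \<Rightarrow> nat \<Rightarrow> nat \<Rightarrow> 'v" where
  "d0_gen m n \<alpha>2 V \<iota> i j =
     (\<Sum>r | r \<in> {1..m+n} \<and> col m i > col m r \<and> col m r \<ge> col m j.
        nprod V (aff V \<iota> (E r j) 1) (-1) (aff V \<iota> (Psi i r) 1))
   - (\<Sum>r | r \<in> {1..m+n} \<and> col m j < col m r \<and> col m r \<le> col m i.
        nprod V (aff V \<iota> (Psi r j) 1) (-1) (aff V \<iota> (E i r) 1))
   + (if col m i > col m j then smult V \<alpha>2 (aff V \<iota> (Psi i j) 2) else 0)
   + (if m - n < i \<and> i \<le> m then aff V \<iota> (Psi (i + n) j) 1 else 0)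
   - (if m < j \<and> j \<le> m + n then aff V \<iota> (Psi i (j - n)) 1 else 0)"

text \<open>
  \<open>d\<close> restricted to \<open>Vb\<close> is the odd derivation \<open>d\<^sub>0\<close>. There is no sign in the derivation rule
  since \<open>Vb\<close> is purely even. Values of \<open>d\<close> outside \<open>Vb\<close> are irrelevant.
\<close>

definition is_d0 ::
  "nat \<Rightarrow> nat \<Rightarrow> complex \<Rightarrow> ('v::ab_group_add) vertex_data \<Rightarrow> (gen \<Rightarrow> 'v) \<Rightarrow> ('v \<Rightarrow> 'v) \<Rightarrow> bool" where
  "is_d0 m n \<alpha>2 V \<iota> d \<longleftrightarrow>
     (\<forall>a\<in>Vb m n V \<iota>. \<forall>b\<in>Vb m n V \<iota>. d (a + b) = d a + d b) \<and>
     (\<forall>c. \<forall>a\<in>Vb m n V \<iota>. d (smult V c a) = smult V c (d a)) \<and>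
     (\<forall>a\<in>Vb m n V \<iota>. d a \<in> vpart V True) \<and>
     (\<forall>a\<in>Vb m n V \<iota>. \<forall>b\<in>Vb m n V \<iota>. \<forall>k.
        d (nprod V a k b) = nprod V (d a) k b + nprod V a k (d b)) \<and>
     d (vac V) = 0 \<and>
     (\<forall>a\<in>Vb m n V \<iota>. d (transl V a) = transl V (d a)) \<and>
     (\<forall>i j. E i j \<in> b_basis m n \<longrightarrow> d (aff V \<iota> (E i j) 1) = d0_gen m n \<alpha>2 V \<iota> i j)"

definition W_algebra ::
  "nat \<Rightarrow> nat \<Rightarrow> ('v::ab_group_add) vertex_data \<Rightarrow> (gen \<Rightarrow> 'v) \<Rightarrow> ('v \<Rightarrow> 'v) \<Rightarrow> 'v set" where
  "W_algebra m n V \<iota> d0 = {y \<in> Vb m n V \<iota>. d0 y = 0}"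

definition W1 ::
  "nat \<Rightarrow> nat \<Rightarrow> ('v::ab_group_add) vertex_data \<Rightarrow> (gen \<Rightarrow> 'v) \<Rightarrow> nat \<Rightarrow> nat \<Rightarrow> 'v" where
  "W1 m n V \<iota> i j =
     (\<Sum>(h, l) | h \<in> {1..m+n} \<and> l \<in> {1..m+n} \<and> row m n h = i \<and> row m n l = j \<and> col m h = col m l.
        aff V \<iota> (E h l) 1)"

definition W2 ::
  "nat \<Rightarrow> nat \<Rightarrow> complex \<Rightarrow> ('v::ab_group_add) vertex_data \<Rightarrow> (gen \<Rightarrow> 'v) \<Rightarrow> nat \<Rightarrow> nat \<Rightarrow> 'v" where
  "W2 m n \<alpha>2 V \<iota> i j =
     aff V \<iota> (E (i + n) j) 1 - smult V \<alpha>2 (aff V \<iota> (E i j) 2)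
   + (\<Sum>u\<in>{m-n<..m}. nprod V (aff V \<iota> (E u j) 1) (-1) (aff V \<iota> (E (i + n) (u + n)) 1))
   - (\<Sum>u\<in>{1..m-n}. nprod V (aff V \<iota> (E u j) 1) (-1) (aff V \<iota> (E i u) 1))"

end

theory Submission
  imports Defs
begin

text \<open>
  Filter by the Kazhdan degree (\<open>2\<close> for \<open>E i j\<close> with \<open>i\<close>, \<open>j\<close> in different columns, \<open>1\<close> for all
  other generators). Besides the \<open>W\<close>'s only the letters \<open>E i j\<close> with \<open>m - n < i \<le> m\<close> and \<open>j \<le> m\<close>
  are needed to generate \<open>V\<^sup>\<kappa>(\<b>)\<close> strongly, and \<open>d\<^sub>0\<close> maps them bijectively to the odd letters. A
  contraction \<open>h\<close> that moves an odd letter to the right end of a word and replaces it by its preimage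
  is compatible with the relations of the enveloping algebra, so it exists on \<open>V\<^sup>\<kappa>(\<a>)\<close> without any
  appeal to a PBW basis. Up to lower degree \<open>h \<circ> d\<^sub>0\<close> multiplies a word by the number \<open>r\<close> of its
  letters \<open>E i j\<close>. Hence on the kernel of \<open>d\<^sub>0\<close> the parts of leading degree with \<open>r > 0\<close> can be
  removed one after the other, what is left in leading degree is a combination of words in the
  \<open>W\<close>'s, and induction on the degree finishes the proof.
\<close>

section \<open>Linear extensions\<close>

lemma lookup_pm_scale [simp]: "Poly_Mapping.lookup (pm_scale c p) x = c * Poly_Mapping.lookup p x"
  by (simp add: pm_scale_def Poly_Mapping.map.rep_eq when_def)

lemma vector_space_pm_scale: "vector_space (pm_scale :: complex \<Rightarrow> ('x \<Rightarrow>\<^sub>0 complex) \<Rightarrow> _)"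
  by unfold_locales (auto intro!: poly_mapping_eqI simp: lookup_add algebra_simps)

lemma keys_pm_scale_subset: "Poly_Mapping.keys (pm_scale c p) \<subseteq> Poly_Mapping.keys p"
  by (auto simp: in_keys_iff)

locale complex_vector_space = vector_space scale
  for scale :: "complex \<Rightarrow> 'b::ab_group_add \<Rightarrow> 'b"
begin

lemma lin_ext_superset:
  assumes "finite A" "Poly_Mapping.keys p \<subseteq> A"
  shows "lin_ext scale f p = (\<Sum>x\<in>A. scale (Poly_Mapping.lookup p x) (f x))"
  unfolding lin_ext_def using assms by (intro sum.mono_neutral_left) (auto simp: in_keys_iff)

lemma lin_ext_add: "lin_ext scale f (p + q) = lin_ext scale f p + lin_ext scale f q"
proof -
  let ?A = "Poly_Mapping.keys p \<union> Poly_Mapping.keys q"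
  have "Poly_Mapping.keys (p + q) \<subseteq> ?A"
    by (rule Poly_Mapping.keys_add)
  then show ?thesis
    by (simp add: lin_ext_superset[of ?A] lookup_add scale_left_distrib sum.distrib)
qed

lemma lin_ext_scale: "lin_ext scale f (pm_scale c p) = scale c (lin_ext scale f p)"
  by (simp add: lin_ext_superset[OF _ keys_pm_scale_subset, of p] scale_sum_right lin_ext_def[of _ _ p])

lemma lin_ext_0 [simp]: "lin_ext scale f 0 = 0"
  by (simp add: lin_ext_def)

lemma lin_ext_single: "lin_ext scale f (Poly_Mapping.single x c) = scale c (f x)"
  by (cases "c = 0") (auto simp: lin_ext_def)

lemma lin_ext_uminus: "lin_ext scale f (- p) = - lin_ext scale f p"
  using lin_ext_add[of f p "- p"] by (simp add: eq_neg_iff_add_eq_0 add.commute)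

lemma lin_ext_diff: "lin_ext scale f (p - q) = lin_ext scale f p - lin_ext scale f q"
  using lin_ext_add[of f p "- q"] by (simp add: lin_ext_uminus)

text \<open>The bracket term of \<open>env_relation\<close> is itself a linear extension over
  \<open>br x y\<close>; this evaluates a further linear map on it.\<close>

lemma lin_ext_comp:
  "lin_ext scale f (lin_ext pm_scale (\<lambda>z. Poly_Mapping.single (g z) 1) p) = lin_ext scale (\<lambda>z. f (g z)) p"
proof -
  have "lin_ext scale f (\<Sum>z\<in>A. pm_scale (c z) (Poly_Mapping.single (g z) 1)) = (\<Sum>z\<in>A. scale (c z) (f (g z)))"
    if "finite A" for A c
    using that by induction (auto simp: lin_ext_add lin_ext_scale lin_ext_single)
  then show ?thesis
    by (simp add: lin_ext_def[of pm_scale] lin_ext_def[of _ _ p])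
qed

lemma lin_ext_in_subspace:
  assumes "subspace S" "\<And>x. x \<in> Poly_Mapping.keys p \<Longrightarrow> f x \<in> S"
  shows "lin_ext scale f p \<in> S"
  unfolding lin_ext_def using assms by (intro subspace_sum subspace_scale) auto

lemma lin_ext_in_span:
  assumes "Poly_Mapping.keys p \<subseteq> A"
  shows "lin_ext scale f p \<in> span (f ` A)"
  using assms by (intro lin_ext_in_subspace subspace_span span_base) auto

end

section \<open>Modes\<close>

sublocale vertex_superalgebra \<subseteq> VS: complex_vector_space "smult V"
  by (simp add: complex_vector_space_def vs)

context vertex_superalgebra
begin

lemma hom_right: "module_hom (smult V) (smult V) (nprod V a n)"
  using nprod_linear_right by (simp add: module_hom_iff_linear)

lemma hom_left: "module_hom (smult V) (smult V) (\<lambda>a. nprod V a n b)"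
  using nprod_linear_left by (simp add: module_hom_iff_linear)

lemmas nprod_add_right = module_hom.add[OF hom_right]
  and nprod_diff_right = module_hom.diff[OF hom_right]
  and nprod_scale_right = module_hom.scale[OF hom_right]
  and nprod_zero_right [simp] = module_hom.zero[OF hom_right]
  and nprod_neg_right = module_hom.neg[OF hom_right]
  and nprod_add_left = module_hom.add[OF hom_left]
  and nprod_diff_left = module_hom.diff[OF hom_left]
  and nprod_scale_left = module_hom.scale[OF hom_left]
  and nprod_zero_left [simp] = module_hom.zero[OF hom_left]
  and nprod_sum_left = module_hom.sum[OF hom_left]

text \<open>Follows from the creation axiom applied to \<open>transl V a\<close>. It makes
  translates of states accessible as modes acting on the vacuum.\<close>

lemma transl_eq: "transl V a = nprod V a (-2) (vac V)"
  using creation[of "transl V a"] transl_nprod[of a "-1" "vac V"] by simp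

lemma nprod_maps_span:
  assumes "v \<in> VS.span A" "VS.subspace S" "\<And>w. w \<in> A \<Longrightarrow> nprod V a k w \<in> S"
  shows "nprod V a k v \<in> S"
  using assms(1)
proof (induction rule: VS.span_induct_alt)
  case base then show ?case using assms(2) by (simp add: VS.subspace_0)
next
  case (step c x y)
  then show ?case using assms(2,3)
    by (simp add: nprod_add_right nprod_scale_right VS.subspace_add VS.subspace_scale)
qed

lemma gbinomial_zero_left: "(0::complex) gchoose j = of_bool (j = 0)"
  by (cases j) auto

text \<open>The Borcherds identity with \<open>n = 0\<close>: the binomials
  \<open>0 gchoose j\<close> leave only \<open>j = 0\<close> on the right-hand side, which is the
  supercommutator.\<close>

lemma commutator:
  assumes "a \<in> vpart V p" "b \<in> vpart V q"
  shows "nprod V a i (nprod V b k c) = smult V (koszul_sign p q) (nprod V b k (nprod V a i c))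
    + Sum_any (\<lambda>j. smult V (of_int i gchoose j) (nprod V (nprod V a (int j) b) (i + k - int j) c))"
proof -
  have "Sum_any (\<lambda>j. smult V ((-1) ^ j * (of_int 0 gchoose j))
            (nprod V a (i + 0 - int j) (nprod V b (k + int j) c)
             - smult V ((-1) powi 0 * koszul_sign p q)
                 (nprod V b (0 + k - int j) (nprod V a (i + int j) c))))
      = Sum_any (\<lambda>j::nat. (nprod V a i (nprod V b k c)
             - smult V (koszul_sign p q) (nprod V b k (nprod V a i c))) when j = 0)"
    by (rule Sum_any.cong) (simp add: gbinomial_zero_left when_def)
  also have "\<dots> = nprod V a i (nprod V b k c)
             - smult V (koszul_sign p q) (nprod V b k (nprod V a i c))"
    by simp
  finally show ?thesis
    using borcherds[OF assms, of i 0 k c] by (simp add: algebra_simps)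
qed

text \<open>The Borcherds identity with \<open>m = 0\<close>, \<open>n = -1\<close>: now the
  left-hand side collapses to \<open>j = 0\<close>, and the signed binomials of -1 are all 1. The
  factor \<open>(-1) powi (-1)\<close> turns the inner minus into a plus.\<close>

lemma normal_product:
  assumes "a \<in> vpart V p" "b \<in> vpart V q"
  shows "nprod V (nprod V a (-1) b) k c =
    Sum_any (\<lambda>j. nprod V a (-1 - int j) (nprod V b (k + int j) c)
       + smult V (koszul_sign p q) (nprod V b (k - 1 - int j) (nprod V a (int j) c)))"
proof -
  have *: "(-1) ^ j * ((-1::complex) gchoose j) = 1" for j
  proof -
    have "(of_nat j :: complex) gchoose j = 1"
      by (simp flip: binomial_gbinomial)
    then show ?thesis
      using gbinomial_minus[of "1::complex" j] by (simp flip: power_add mult.assoc)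
  qed
  have "Sum_any (\<lambda>j. smult V (of_int 0 gchoose j) (nprod V (nprod V a (-1 + int j) b) (0 + k - int j) c))
    = Sum_any (\<lambda>j::nat. nprod V (nprod V a (-1) b) k c when j = 0)"
    by (rule Sum_any.cong) (simp add: gbinomial_zero_left when_def)
  also have "\<dots> = nprod V (nprod V a (-1) b) k c"
    by simp
  finally show ?thesis
    using borcherds[OF assms, of 0 "-1" k c] * by (simp add: algebra_simps VS.scale_right_diff_distrib VS.scale_minus_left)
qed

end

section \<open>Filtrations of universal affine vertex superalgebras\<close>

locale affine_vertex_superalgebra =
  fixes V :: "('v::ab_group_add) vertex_data" and B :: "'x set" and par br \<kappa> \<iota>
  assumes affine: "universal_affine V B par br \<kappa> \<iota>"

sublocale affine_vertex_superalgebra \<subseteq> vertex_superalgebra V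
  using affine unfolding universal_affine_def by (rule conjunct1)

context affine_vertex_superalgebra
begin

abbreviation mode :: "'x \<Rightarrow> int \<Rightarrow> 'v \<Rightarrow> 'v" where
  "mode x k \<equiv> nprod V (\<iota> x) k"

abbreviation word :: "('x \<times> nat) list \<Rightarrow> 'v" where
  "word \<equiv> word_vec V \<iota>"

abbreviation lext :: "('y \<Rightarrow> 'v) \<Rightarrow> ('y \<Rightarrow>\<^sub>0 complex) \<Rightarrow> 'v" where
  "lext \<equiv> lin_ext (smult V)"

lemma word_Nil [simp]: "word [] = vac V"
  by (simp add: word_vec_def creation_vec_def)

lemma word_Cons: "word (l # w) = mode (fst l) (- int (snd l)) (word w)"
  by (cases l) (simp add: word_vec_def creation_vec_def)

lemma neg_words_Nil [simp]: "[] \<in> neg_words A"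
  by (simp add: neg_words_def)

lemma neg_words_Cons [simp]:
  "l # w \<in> neg_words A \<longleftrightarrow> fst l \<in> A \<and> 1 \<le> snd l \<and> w \<in> neg_words A"
  by (cases l) (auto simp: neg_words_def)

lemma nprod_lin_ext: "nprod V (lext f p) k c = lext (\<lambda>z. nprod V (f z) k c) p"
  by (simp add: lin_ext_def nprod_sum_left nprod_scale_left)

lemma ope:
  assumes "x \<in> B" "y \<in> B"
  shows "mode x 0 (\<iota> y) = lext \<iota> (br x y)" "mode x 1 (\<iota> y) = smult V (\<kappa> x y) (vac V)"
    "n \<ge> 2 \<Longrightarrow> mode x n (\<iota> y) = 0"
  using affine assms unfolding universal_affine_def by blast+

lemma par_gen: "x \<in> B \<Longrightarrow> \<iota> x \<in> vpart V (par x)"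
  using affine unfolding universal_affine_def by blast

text \<open>By the OPE only \<open>j = 0\<close> (bracket) and \<open>j = 1\<close> (form)
  contribute to the commutator formula. The latter involves a mode of the vacuum, which is nonzero
  only for index -1, that is, for \<open>i + k = 0\<close>.\<close>

lemma mode_commute:
  assumes "x \<in> B" "y \<in> B"
  shows "mode x i (mode y k c) = smult V (koszul_sign (par x) (par y)) (mode y k (mode x i c))
    + lext (\<lambda>z. mode z (i + k) c) (br x y)
    + smult V (if i + k = 0 then of_int i * \<kappa> x y else 0) c"
proof -
  note ope = ope[OF assms] and par = par_gen[OF assms(1)] par_gen[OF assms(2)]
  have "Sum_any (\<lambda>j. smult V (of_int i gchoose j) (nprod V (mode x (int j) (\<iota> y)) (i + k - int j) c))
     = (\<Sum>j\<in>{0,1::nat}. smult V (of_int i gchoose j) (nprod V (mode x (int j) (\<iota> y)) (i + k - int j) c))"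
  proof (rule Sum_any.expand_superset)
    have "smult V (of_int i gchoose j) (nprod V (mode x (int j) (\<iota> y)) (i + k - int j) c) = 0"
      if "j \<notin> {0, 1}" for j
    proof -
      have "2 \<le> int j" using that by auto
      then show ?thesis by (simp add: ope(3))
    qed
    then show "{j. smult V (of_int i gchoose j) (nprod V (mode x (int j) (\<iota> y)) (i + k - int j) c) \<noteq> 0}
        \<subseteq> {0, 1}"
      by blast
  qed simp
  also have "\<dots> = lext (\<lambda>z. mode z (i + k) c) (br x y)
    + smult V (if i + k = 0 then of_int i * \<kappa> x y else 0) c"
    by (simp add: ope nprod_lin_ext nprod_scale_left vac_left)
  finally show ?thesis
    unfolding commutator[OF par] by (simp add: add.assoc)
qed

text \<open>For creation modes the indices cannot add up to 0, so the central term is absent and the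
  relation is the one of the enveloping algebra.\<close>

lemma mode_commute_neg:
  assumes "x \<in> B" "y \<in> B" "1 \<le> s"
  shows "mode x (- int s) (mode y (- int t) c) =
    smult V (koszul_sign (par x) (par y)) (mode y (- int t) (mode x (- int s) c))
    + lext (\<lambda>z. mode z (- int (s + t)) c) (br x y)"
  using mode_commute[OF assms(1,2), of "- int s" "- int t" c] assms(3) by simp

lemma in_span_words: "v \<in> VS.span (word ` neg_words B)"
proof -
  obtain p where "Poly_Mapping.keys p \<subseteq> neg_words B" "v = lext word p"
    using affine unfolding universal_affine_def by blast
  then show ?thesis
    by (simp add: VS.lin_ext_in_span)
qed

end

text \<open>The strict inequality in \<open>dg_bracket\<close> says that letters supercommute modulo
  lower degree, so every reordering of a word is an error of lower degree.\<close>

locale filtered_affine = affine_vertex_superalgebra V B par br \<kappa> \<iota>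
  for V :: "('v::ab_group_add) vertex_data" and B :: "'x set" and par br \<kappa> \<iota> +
  fixes dg :: "'x \<Rightarrow> nat"
  assumes dg_pos: "x \<in> B \<Longrightarrow> 0 < dg x"
    and dg_bracket: "x \<in> B \<Longrightarrow> y \<in> B \<Longrightarrow> z \<in> Poly_Mapping.keys (br x y) \<Longrightarrow> dg z < dg x + dg y"
begin

definition wdeg :: "('x \<times> nat) list \<Rightarrow> nat" where
  "wdeg w = (\<Sum>(x, s)\<leftarrow>w. dg x)"

lemma wdeg_simps [simp]: "wdeg [] = 0" "wdeg (l # w) = dg (fst l) + wdeg w"
  by (auto simp: wdeg_def split: prod.split)

text \<open>The bound is strict so that \<open>Filt A 0\<close> is zero, which starts inductions; a
  word of degree p lies in \<open>Filt A (Suc p)\<close>. The alphabet A is a parameter because the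
  estimates are needed for both \<aa> and \<bb>.\<close>

definition Filt :: "'x set \<Rightarrow> nat \<Rightarrow> 'v set" where
  "Filt A p = VS.span (word ` {w \<in> neg_words A. wdeg w < p})"

definition subalg :: "'x set \<Rightarrow> bool" where
  "subalg A \<longleftrightarrow> A \<subseteq> B \<and> (\<forall>x\<in>A. \<forall>y\<in>A. Poly_Mapping.keys (br x y) \<subseteq> A)"

lemma subspace_Filt [simp, intro]: "VS.subspace (Filt A p)"
  by (simp add: Filt_def)

lemmas Filt_add = VS.subspace_add[OF subspace_Filt]
  and Filt_diff = VS.subspace_diff[OF subspace_Filt]
  and Filt_scale = VS.subspace_scale[OF subspace_Filt]
  and Filt_sum = VS.subspace_sum[OF subspace_Filt]
  and Filt_zero [simp] = VS.subspace_0[OF subspace_Filt]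

lemma Filt_mono: "p \<le> q \<Longrightarrow> Filt A p \<subseteq> Filt A q"
  unfolding Filt_def by (intro VS.span_mono) auto

lemma Filt_monoD: "v \<in> Filt A p \<Longrightarrow> p \<le> q \<Longrightarrow> v \<in> Filt A q"
  using Filt_mono by blast

lemma Filt_word: "w \<in> neg_words A \<Longrightarrow> wdeg w < p \<Longrightarrow> word w \<in> Filt A p"
  unfolding Filt_def by (intro VS.span_base) auto

lemma Filt_exhaust:
  assumes "v \<in> VS.span (word ` neg_words A)"
  obtains p where "v \<in> Filt A p"
proof -
  have "\<exists>p. v \<in> Filt A p"
    using assms
  proof (induction rule: VS.span_induct_alt)
    case (step c x y)
    then obtain p w where p: "y \<in> Filt A p" "w \<in> neg_words A" "x = word w"
      by auto
    then have "smult V c x + y \<in> Filt A (max p (Suc (wdeg w)))"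
      by (intro Filt_add Filt_scale) (auto intro: Filt_word Filt_monoD[OF p(1)])
    then show ?case ..
  qed (auto intro: Filt_zero)
  with that show ?thesis by blast
qed

lemma Filt_subset_span: "Filt A p \<subseteq> VS.span (word ` neg_words A)"
  unfolding Filt_def by (rule VS.span_mono) auto

text \<open>A negative mode only puts one more letter in front of each word.\<close>

lemma neg_mode_Filt:
  assumes "x \<in> A" "k < 0" "v \<in> Filt A p"
  shows "mode x k v \<in> Filt A (p + dg x)"
  using assms(3) unfolding Filt_def[of A p]
proof (rule nprod_maps_span)
  fix u assume "u \<in> word ` {w \<in> neg_words A. wdeg w < p}"
  then obtain w where w: "u = word w" "w \<in> neg_words A" "wdeg w < p"
    by auto
  have "mode x k u = word ((x, nat (- k)) # w)"
    using assms(2) w by (simp add: word_Cons)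
  then show "mode x k u \<in> Filt A (p + dg x)"
    using assms(1,2) w by (auto intro!: Filt_word)
qed simp

text \<open>The mode is commuted through the word until it kills the vacuum, so only bracket and
  central terms survive, and each of them has lower degree. A bracket term carries another letter
  and a possibly still nonnegative index, hence the generalization over x and k.\<close>

lemma nonneg_mode_word:
  assumes "subalg A" "x \<in> A" "0 \<le> k" "w \<in> neg_words A" 
  shows "mode x k (word w) \<in> Filt A (wdeg w + dg x)"
  using assms(2-)
proof (induction w arbitrary: x k)
  case Nil
  then show ?case by (simp add: vac_right)
next
  case (Cons l w)
  obtain y t where l: "l = (y, t)" by (cases l)
  have y: "y \<in> A" "1 \<le> t" "w \<in> neg_words A" and AB: "A \<subseteq> B"
    using Cons.prems assms(1) by (auto simp: l subalg_def)
  have w: "word w \<in> Filt A (Suc (wdeg w))"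
    using y by (intro Filt_word) auto
  have pos: "0 < dg x" "0 < dg y"
    using dg_pos AB y Cons.prems by auto
  have 1: "mode y (- int t) (mode x k (word w)) \<in> Filt A (wdeg w + dg x + dg y)"
    using y Cons.prems by (intro neg_mode_Filt Cons.IH) auto
  have 2: "mode z (k - int t) (word w) \<in> Filt A (wdeg w + dg x + dg y)"
    if "z \<in> Poly_Mapping.keys (br x y)" for z
  proof -
    have z: "z \<in> A" "dg z < dg x + dg y"
      using that assms(1) y Cons.prems dg_bracket[of x y z] by (auto simp: subalg_def)
    have "mode z (k - int t) (word w) \<in> Filt A (Suc (wdeg w) + dg z)"
    proof (cases "k - int t < 0")
      case True
      then show ?thesis using neg_mode_Filt[OF z(1) True w] by simp
    next
      case False
      then show ?thesis
        by (intro Filt_monoD[OF Cons.IH[OF z(1) _ y(3)]]) auto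
    qed
    then show ?thesis
      by (rule Filt_monoD) (use z in simp)
  qed
  have 3: "word w \<in> Filt A (wdeg w + dg x + dg y)"
    by (rule Filt_monoD[OF w]) (use pos in simp)
  have "mode x k (word (l # w)) = smult V (koszul_sign (par x) (par y)) (mode y (- int t) (mode x k (word w)))
    + lext (\<lambda>z. mode z (k - int t) (word w)) (br x y)
    + smult V (if k - int t = 0 then of_int k * \<kappa> x y else 0) (word w)"
    using mode_commute[of x y k "- int t" "word w"] subsetD[OF AB y(1)] subsetD[OF AB Cons.prems(1)]
    by (simp add: l word_Cons)
  also have "\<dots> \<in> Filt A (wdeg w + dg x + dg y)"
    using 1 2 3 by (intro Filt_add Filt_scale VS.lin_ext_in_subspace) auto
  finally show ?case
    by (simp add: l algebra_simps)
qed

lemma nonneg_mode_Filt: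
  assumes "subalg A" "x \<in> A" "0 \<le> k" "v \<in> Filt A p"
  shows "mode x k v \<in> Filt A (p + dg x - 1)"
  using assms(4) unfolding Filt_def[of A p]
proof (rule nprod_maps_span)
  fix u assume "u \<in> word ` {w \<in> neg_words A. wdeg w < p}"
  then obtain w where w: "u = word w" "w \<in> neg_words A" "wdeg w < p"
    by auto
  then show "mode x k u \<in> Filt A (p + dg x - 1)"
    using Filt_monoD[OF nonneg_mode_word[OF assms(1-3) w(2)]] by auto
qed simp

lemma mode_Filt:
  assumes "subalg A" "x \<in> A" "v \<in> Filt A p"
  shows "mode x k v \<in> Filt A (p + dg x)"
proof (cases "k < 0")
  case True
  then show ?thesis using assms neg_mode_Filt by blast
next
  case False
  then show ?thesis
    using assms by (intro Filt_monoD[OF nonneg_mode_Filt[of A x k v p]]) auto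
qed

text \<open>These are the terms of \<open>normal_product\<close> at index -s in which both modes are
  negative; there are exactly s of them.\<close>

definition neg_normal :: "'x \<Rightarrow> 'x \<Rightarrow> nat \<Rightarrow> 'v \<Rightarrow> 'v" where
  "neg_normal x y s v = (\<Sum>j<s. mode x (- int (Suc j)) (mode y (- int (s - j)) v))"

lemma neg_normal_Filt:
  assumes "x \<in> A" "y \<in> A" "v \<in> Filt A p"
  shows "neg_normal x y s v \<in> Filt A (p + dg x + dg y)"
  unfolding neg_normal_def
proof (rule Filt_sum)
  fix j assume "j \<in> {..<s}"
  then show "mode x (- int (Suc j)) (mode y (- int (s - j)) v) \<in> Filt A (p + dg x + dg y)"
    using neg_mode_Filt[OF assms(1) _ neg_mode_Filt[OF assms(2) _ assms(3)],
        of "- int (Suc j)" "- int (s - j)"] by (simp add: algebra_simps)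
qed

text \<open>Every other term of the expansion contains a nonnegative mode, and such a mode costs one
  degree more than a negative one.\<close>

lemma normal_product_Filt:
  assumes "subalg A" "x \<in> A" "y \<in> A" "v \<in> Filt A p"
  shows "nprod V (mode x (-1) (\<iota> y)) (- int s) v - neg_normal x y s v \<in> Filt A (p + dg x + dg y - 1)"
proof -
  have B: "x \<in> B" "y \<in> B" using assms by (auto simp: subalg_def)
  define f where "f j = mode x (-1 - int j) (mode y (- int s + int j) v)" for j
  define g where "g j = smult V (koszul_sign (par x) (par y))
      (mode y (- int s - 1 - int j) (mode x (int j) v))" for j
  obtain N1 where N1: "\<And>k. k \<ge> N1 \<Longrightarrow> mode x k v = 0"
    using field[of "\<iota> x" v] by blast
  obtain N2 where N2: "\<And>k. k \<ge> N2 \<Longrightarrow> mode y k v = 0"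
    using field[of "\<iota> y" v] by blast
  \<comment> \<open>Beyond M both kinds of terms vanish; the summand s compensates for the shift in
    \<open>f\<close> and ensures that all of \<open>neg_normal\<close> lies below the cut.\<close>
  define M where "M = nat N1 + nat N2 + s"
  have van: "f j + g j = 0" if "\<not> j < M" for j
    using that N1[of "int j"] N2[of "- int s + int j"] by (auto simp: f_def g_def M_def)
  note par = par_gen[OF B(1)] par_gen[OF B(2)]
  have "nprod V (mode x (-1) (\<iota> y)) (- int s) v = Sum_any (\<lambda>j. f j + g j)"
    unfolding normal_product[OF par] f_def g_def by simp
  also have "\<dots> = (\<Sum>j<M. f j + g j)"
    using van by (intro Sum_any.expand_superset) auto
  finally have 1: "nprod V (mode x (-1) (\<iota> y)) (- int s) v = (\<Sum>j<M. f j + g j)" .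
  have "neg_normal x y s v = (\<Sum>j<s. f j)"
    unfolding neg_normal_def f_def by (intro sum.cong refl) (simp add: of_nat_diff)
  also have "\<dots> = (\<Sum>j<M. if j < s then f j else 0)"
    by (intro sum.mono_neutral_cong_left) (auto simp: M_def)
  finally have "nprod V (mode x (-1) (\<iota> y)) (- int s) v - neg_normal x y s v
      = (\<Sum>j<M. g j + (if j < s then 0 else f j))"
    unfolding 1 sum_subtractf[symmetric] by (simp only: sum_subtractf[symmetric]) (intro sum.cong, auto)
  also have "\<dots> \<in> Filt A (p + dg x + dg y - 1)"
  proof (intro Filt_sum Filt_add)
    fix j
    have pos: "0 < dg x" "0 < dg y" using dg_pos B by auto
    show "g j \<in> Filt A (p + dg x + dg y - 1)"
      unfolding g_def using nonneg_mode_Filt[OF assms(1,2) _ assms(4), of "int j"] pos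
        neg_mode_Filt[OF assms(3), of "- int s - 1 - int j" "mode x (int j) v" "p + dg x - 1"]
      by (intro Filt_scale) (auto simp: algebra_simps)
    show "(if j < s then 0 else f j) \<in> Filt A (p + dg x + dg y - 1)"
      unfolding f_def using nonneg_mode_Filt[OF assms(1,3) _ assms(4), of "int j - int s"] pos
        neg_mode_Filt[OF assms(2), of "- 1 - int j" "mode y (int j - int s) v" "p + dg y - 1"]
      by (auto simp: algebra_simps)
  qed
  finally show ?thesis .
qed

end

section \<open>The Kazhdan degree on the basis of \<aa>\<close>

fun gdeg :: "nat \<Rightarrow> gen \<Rightarrow> nat" where
  "gdeg m (E i j) = (if col m i = col m j then 1 else 2)"
| "gdeg m (Psi i j) = 1"

lemma E_in_b_basis: "E i j \<in> b_basis m n \<longleftrightarrow> i \<in> {1..m+n} \<and> j \<in> {1..m+n} \<and> (i \<le> m \<longrightarrow> j \<le> m)"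
  by (auto simp: b_basis_def col_def)

lemma E_in_a_basis: "E i j \<in> a_basis m n \<longleftrightarrow> E i j \<in> b_basis m n"
  by (auto simp: a_basis_def)

lemma Psi_in_b_basis [simp]: "Psi i j \<notin> b_basis m n"
  by (auto simp: b_basis_def)

lemma Psi_in_a_basis: "Psi i j \<in> a_basis m n \<longleftrightarrow> i \<in> {m<..m+n} \<and> j \<in> {1..m}"
  by (auto simp: a_basis_def b_basis_def col_def)

lemma b_subset_a: "b_basis m n \<subseteq> a_basis m n"
  by (auto simp: a_basis_def)

lemma neg_words_b_a: "w \<in> neg_words (b_basis m n) \<Longrightarrow> w \<in> neg_words (a_basis m n)"
  using b_subset_a[of m n] unfolding neg_words_def by blast

lemmas basis_simps = E_in_b_basis E_in_a_basis Psi_in_a_basis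

lemma same_col:
  assumes "E i j \<in> b_basis m n" "col m i = col m j"
  shows "i \<in> {1..m+n} \<and> j \<in> {1..m+n} \<and> (i \<le> m \<longleftrightarrow> j \<le> m)"
  using assms by (cases "i \<le> m"; cases "j \<le> m") (simp_all add: E_in_b_basis col_def)

lemma gdeg_1_same_col: "gdeg m (E i j) = 1 \<Longrightarrow> col m i = col m j"
  by (cases "col m i = col m j") simp_all

text \<open>Units within one column preserve the kind of the letter they act on, and the remaining
  letters (units of degree 2 and odd letters) have zero brackets among themselves. So a bracket has
  at most the larger of the two degrees, which is strictly less than their sum.\<close>

lemma keys_a_bracket:
  assumes "x \<in> a_basis m n" "y \<in> a_basis m n" "z \<in> Poly_Mapping.keys (a_bracket x y)"
  shows "z \<in> a_basis m n \<and> gdeg m z < gdeg m x + gdeg m y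
    \<and> (x \<in> b_basis m n \<longrightarrow> y \<in> b_basis m n \<longrightarrow> z \<in> b_basis m n)"
  using assms
  by (cases x; cases y) (auto simp: basis_simps col_def in_keys_iff lookup_minus lookup_single when_def
      split: if_splits)

locale gl_w_algebra =
  fixes m n :: nat and \<alpha>1 \<alpha>2 :: complex
    and V :: "('v::ab_group_add) vertex_data" and \<iota> :: "gen \<Rightarrow> 'v" and d0 :: "'v \<Rightarrow> 'v"
  assumes n_le_m: "n \<le> m"
    and affine: "universal_affine V (a_basis m n) gen_odd a_bracket (kappa m n \<alpha>1 \<alpha>2) \<iota>"
    and d0: "is_d0 m n \<alpha>2 V \<iota> d0"

sublocale gl_w_algebra \<subseteq>
  filtered_affine V "a_basis m n" gen_odd a_bracket "kappa m n \<alpha>1 \<alpha>2" \<iota> "gdeg m"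
proof
  show "universal_affine V (a_basis m n) gen_odd a_bracket (kappa m n \<alpha>1 \<alpha>2) \<iota>"
    by (rule affine)
  show "0 < gdeg m x" for x
    by (cases x) auto
qed (use keys_a_bracket in blast)

context gl_w_algebra
begin

abbreviation "\<aa> \<equiv> a_basis m n"
abbreviation "\<bb> \<equiv> b_basis m n"

lemma subalg_a: "subalg \<aa>"
  using keys_a_bracket unfolding subalg_def by blast

lemma subalg_b: "subalg \<bb>"
  using keys_a_bracket b_subset_a unfolding subalg_def by blast

section \<open>The contraction\<close>

text \<open>
  \<open>psi_right w p q s\<close> is the word \<open>Psi p q[-s] w\<close>, rewritten by commuting the odd letter to the
  right end and replacing it there by \<open>E (p - n) q\<close>. Words with two odd letters go to \<open>0\<close>.
\<close>

fun psi_right :: "(gen \<times> nat) list \<Rightarrow> nat \<Rightarrow> nat \<Rightarrow> nat \<Rightarrow> 'v" where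
  "psi_right [] p q s = mode (E (p - n) q) (- int s) (vac V)"
| "psi_right ((E i j, t) # w) p q s = mode (E i j) (- int t) (psi_right w p q s)
     + (if i = q then psi_right w p j (s + t) else 0) - (if j = p then psi_right w i q (s + t) else 0)"
| "psi_right ((Psi i j, t) # w) p q s = 0"

text \<open>Letters in front of the first odd one stay in place, which makes the contraction commute
  with negative modes of the \<open>E i j\<close>.\<close>

fun contr_word :: "(gen \<times> nat) list \<Rightarrow> 'v" where
  "contr_word [] = 0"
| "contr_word ((E i j, t) # w) = mode (E i j) (- int t) (contr_word w)"
| "contr_word ((Psi p q, s) # w) = psi_right w p q s"

lemma lext_bracket:
  "lext f (a_bracket (E i j) (E a b)) =
     (if j = a then f (E i b) else 0) - (if i = b then f (E a j) else 0)"
  "lext f (a_bracket (E i j) (Psi a b)) =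
     (if j = a then f (Psi i b) else 0) - (if i = b then f (Psi a j) else 0)"
  "lext f (a_bracket (Psi a b) (E i j)) =
     (if i = b then f (Psi a j) else 0) - (if j = a then f (Psi i b) else 0)"
  by (auto simp: VS.lin_ext_diff VS.lin_ext_single VS.lin_ext_uminus)

lemma psi_right_zero: "\<exists>l\<in>set w. gen_odd (fst l) \<Longrightarrow> psi_right w p q s = 0"
  by (induction w p q s rule: psi_right.induct) auto

lemma mode_commute_E:
  assumes "E i j \<in> \<bb>" "E a b \<in> \<bb>" "1 \<le> s"
  shows "mode (E i j) (- int s) (mode (E a b) (- int t) c) =
     mode (E a b) (- int t) (mode (E i j) (- int s) c)
     + (if j = a then mode (E i b) (- int (s + t)) c else 0)
     - (if i = b then mode (E a j) (- int (s + t)) c else 0)"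
  using mode_commute_neg[of "E i j" "E a b" s t c] assms
  by (simp add: E_in_a_basis lext_bracket koszul_sign_def del: a_bracket.simps)

text \<open>Past the prefix, the relation for the two even modes accounts for the leading terms, and
  the double brackets with the travelling odd letter match by the Jacobi identity. The indices p, q,
  r must be arbitrary since they change each time the odd letter passes another one.\<close>

lemma psi_right_EE:
  assumes "E i j \<in> \<bb>" "E a b \<in> \<bb>" "1 \<le> s"
  shows "psi_right (u @ (E i j, s) # (E a b, t) # w) p q r =
    psi_right (u @ (E a b, t) # (E i j, s) # w) p q r
    + (if j = a then psi_right (u @ (E i b, s + t) # w) p q r else 0)
    - (if i = b then psi_right (u @ (E a j, s + t) # w) p q r else 0)"
proof (induction u arbitrary: p q r)
  case Nil
  have *: "r + (s + t) = r + s + t" "r + t + s = r + s + t"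
    by auto
  show ?case
    by (simp add: mode_commute_E[OF assms] nprod_add_right nprod_diff_right * )
next
  case (Cons l u)
  obtain x t' where l: "l = (x, t')" by (cases l)
  show ?case
  proof (cases x)
    case (E i' j')
    show ?thesis
      unfolding l E append_Cons psi_right.simps Cons.IH
      by (simp add: nprod_add_right nprod_diff_right)
  qed (simp add: l)
qed

lemma contr_word_EE:
  assumes "E i j \<in> \<bb>" "E a b \<in> \<bb>" "1 \<le> s"
  shows "contr_word (u @ (E i j, s) # (E a b, t) # w) =
    contr_word (u @ (E a b, t) # (E i j, s) # w)
    + (if j = a then contr_word (u @ (E i b, s + t) # w) else 0)
    - (if i = b then contr_word (u @ (E a j, s + t) # w) else 0)"
proof (induction u rule: contr_word.induct)
  case 1
  show ?case by (simp add: mode_commute_E[OF assms])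
next
  case (2 i' j' t' u)
  show ?case
    unfolding append_Cons contr_word.simps 2
    by (simp add: nprod_add_right nprod_diff_right)
next
  case (3 p q s' u)
  show ?case by (simp add: psi_right_EE[OF assms])
qed

text \<open>If the displayed odd letter is the first one, this is the recursion defining
  \<open>psi_right\<close>; after an earlier odd letter all terms are 0.\<close>

lemma contr_word_PE:
  "contr_word (u @ (Psi p q, s) # (E i j, t) # w) =
    contr_word (u @ (E i j, t) # (Psi p q, s) # w)
    + (if i = q then contr_word (u @ (Psi p j, s + t) # w) else 0)
    - (if j = p then contr_word (u @ (Psi i q, s + t) # w) else 0)"
proof (induction u rule: contr_word.induct)
  case (2 i' j' t' u)
  show ?case
    unfolding append_Cons contr_word.simps 2
    by (simp add: nprod_add_right nprod_diff_right)
next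
  case (3 p' q' s' u)
  show ?case by (simp add: psi_right_zero)
qed auto

lemma contr_word_PP: "contr_word (u @ (Psi p q, s) # (Psi a b, t) # w) = 0"
  by (induction u rule: contr_word.induct) (auto simp: psi_right_zero)

text \<open>One case for each pair of parities; the mixed cases are \<open>contr_word_PE\<close>
  read in the two directions.\<close>

lemma contr_word_env_relation:
  assumes "u @ [a, b] @ w \<in> neg_words \<aa>"
  shows "lext contr_word (env_relation gen_odd a_bracket u a b w) = 0"
proof -
  obtain x s y t where ab: "a = (x, s)" "b = (y, t)"
    by (cases a; cases b)
  have xy: "x \<in> \<aa>" "y \<in> \<aa>" "1 \<le> s" "1 \<le> t"
    using assms by (auto simp: ab neg_words_def)
  have *: "lext contr_word (env_relation gen_odd a_bracket u a b w) = contr_word (u @ a # b # w)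
     - smult V (koszul_sign (gen_odd x) (gen_odd y)) (contr_word (u @ b # a # w))
     - lext (\<lambda>z. contr_word (u @ (z, s + t) # w)) (a_bracket x y)"
    by (simp add: env_relation_def ab VS.lin_ext_diff VS.lin_ext_single VS.lin_ext_comp)
  show ?thesis
  proof (cases x; cases y)
    fix i j k l assume "x = E i j" "y = E k l"
    then show ?thesis
      using xy contr_word_EE[of i j k l s u t w] unfolding *
      by (simp del: a_bracket.simps add: ab lext_bracket koszul_sign_def E_in_a_basis)
  next
    fix i j k l assume "x = E i j" "y = Psi k l"
    then show ?thesis
      using contr_word_PE[of u k l t i j s w] unfolding *
      by (simp del: a_bracket.simps add: ab lext_bracket koszul_sign_def add.commute)
  next
    fix i j k l assume "x = Psi i j" "y = E k l"
    then show ?thesis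
      using contr_word_PE[of u i j s k l t w] unfolding *
      by (simp del: a_bracket.simps add: ab lext_bracket koszul_sign_def)
  next
    fix i j k l assume "x = Psi i j" "y = Psi k l"
    then show ?thesis
      unfolding * by (simp add: ab contr_word_PP)
  qed
qed

lemma contr_word_env_ideal:
  assumes "p \<in> env_ideal \<aa> gen_odd a_bracket"
  shows "lext contr_word p = 0"
proof -
  interpret pm: vector_space "pm_scale :: complex \<Rightarrow> ((gen \<times> nat) list \<Rightarrow>\<^sub>0 complex) \<Rightarrow> _"
    by (rule vector_space_pm_scale)
  show ?thesis
    using assms unfolding env_ideal_def
  proof (induction rule: pm.span_induct_alt)
    case (step c x y)
    then show ?case
      using contr_word_env_relation by (auto simp: VS.lin_ext_add VS.lin_ext_scale)
  qed simp
qed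

section \<open>Descent of the contraction to the vertex superalgebra\<close>

definition contr :: "'v \<Rightarrow> 'v" where
  "contr v = lext contr_word (SOME p. Poly_Mapping.keys p \<subseteq> neg_words \<aa> \<and> v = lext word p)"

text \<open>Two representatives of one vector differ by an element of \<open>env_ideal\<close>,
  which the contraction kills, so the choice in \<open>contr\<close> is immaterial.\<close>

lemma contr_lext:
  assumes "Poly_Mapping.keys p \<subseteq> neg_words \<aa>"
  shows "contr (lext word p) = lext contr_word p"
proof -
  define q where "q = (SOME q. Poly_Mapping.keys q \<subseteq> neg_words \<aa> \<and> lext word p = lext word q)"
  have "Poly_Mapping.keys q \<subseteq> neg_words \<aa> \<and> lext word p = lext word q"
    unfolding q_def by (rule someI[where x = p]) (use assms in simp)
  then have q: "Poly_Mapping.keys q \<subseteq> neg_words \<aa>" "lext word p = lext word q"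
    by blast+
  have keys: "Poly_Mapping.keys (p - q) \<subseteq> neg_words \<aa>"
    using q(1) assms Poly_Mapping.keys_diff[of p q] by blast
  have "lext word (p - q) = 0"
    using q(2) by (simp add: VS.lin_ext_diff)
  then have "p - q \<in> env_ideal \<aa> gen_odd a_bracket"
    using affine keys unfolding universal_affine_def by blast
  from contr_word_env_ideal[OF this] show ?thesis
    by (simp add: contr_def q_def VS.lin_ext_diff)
qed

lemma obtain_lext: obtains p where "Poly_Mapping.keys p \<subseteq> neg_words \<aa>" "v = lext word p"
  using affine unfolding universal_affine_def by blast

lemma contr_add: "contr (u + v) = contr u + contr v"
proof -
  obtain p q where p: "Poly_Mapping.keys p \<subseteq> neg_words \<aa>" "u = lext word p"
    and q: "Poly_Mapping.keys q \<subseteq> neg_words \<aa>" "v = lext word q"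
    using obtain_lext by metis
  have "Poly_Mapping.keys (p + q) \<subseteq> neg_words \<aa>"
    using p q Poly_Mapping.keys_add[of p q] by blast
  from contr_lext[OF this] show ?thesis
    using p q by (simp add: VS.lin_ext_add contr_lext)
qed

lemma contr_scale: "contr (smult V c v) = smult V c (contr v)"
proof -
  obtain p where p: "Poly_Mapping.keys p \<subseteq> neg_words \<aa>" "v = lext word p"
    using obtain_lext by metis
  have "Poly_Mapping.keys (pm_scale c p) \<subseteq> neg_words \<aa>"
    using p by (intro order_trans[OF keys_pm_scale_subset])
  from contr_lext[OF this] show ?thesis
    using p by (simp add: VS.lin_ext_scale contr_lext)
qed

lemma hom_contr: "module_hom (smult V) (smult V) contr"
  by unfold_locales (simp_all add: contr_add contr_scale)

lemmas contr_diff = module_hom.diff[OF hom_contr]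
  and contr_zero [simp] = module_hom.zero[OF hom_contr]
  and contr_sum = module_hom.sum[OF hom_contr]

lemma contr_word: "w \<in> neg_words \<aa> \<Longrightarrow> contr (word w) = contr_word w"
  using contr_lext[of "Poly_Mapping.single w 1"] by (simp add: VS.lin_ext_single)

text \<open>The index has to be negative: only then does the mode prefix a word by a letter.\<close>

lemma contr_mode_E:
  assumes "E i j \<in> \<bb>" "k < 0"
  shows "contr (mode (E i j) k v) = mode (E i j) k (contr v)"
  using in_span_words[of v]
proof (induction rule: VS.span_induct_alt)
  case (step c x y)
  then obtain w where w: "x = word w" "w \<in> neg_words \<aa>" by auto
  have "(E i j, nat (- k)) # w \<in> neg_words \<aa>"
    using assms w by (simp add: E_in_a_basis)
  from contr_word[OF this] have "contr (mode (E i j) k x) = mode (E i j) k (contr x)"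
    using assms w by (simp add: word_Cons contr_word)
  then show ?case
    using step by (simp add: nprod_add_right nprod_scale_right contr_add contr_scale)
qed simp

lemma contr_mode_Psi:
  assumes "Psi p q \<in> \<aa>" "1 \<le> s" "w \<in> neg_words \<aa>"
  shows "contr (mode (Psi p q) (- int s) (word w)) = psi_right w p q s"
  using contr_word[of "(Psi p q, s) # w"] assms by (simp add: word_Cons)

section \<open>Degree estimates for the contraction\<close>

lemma psi_right_Filt:
  assumes "w \<in> neg_words \<aa>" "Psi p q \<in> \<aa>" "1 \<le> s"
  shows "psi_right w p q s \<in> Filt \<bb> (Suc (Suc (wdeg w)))"
  using assms
proof (induction w p q s rule: psi_right.induct)
  case (1 p q s)
  have "mode (E (p - n) q) (- int s) (word []) \<in> Filt \<bb> (1 + gdeg m (E (p - n) q))"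
    using 1 n_le_m by (intro neg_mode_Filt Filt_word) (auto simp: basis_simps)
  then show ?case
    using 1 by (auto simp: basis_simps col_def numeral_2_eq_2 split: if_splits)
next
  case (2 i j t w p q s)
  have E: "E i j \<in> \<bb>" "1 \<le> t" "w \<in> neg_words \<aa>"
    using 2(4) by (auto simp: E_in_a_basis)
  have a: "mode (E i j) (- int t) (psi_right w p q s) \<in> Filt \<bb> (Suc (Suc (wdeg w)) + gdeg m (E i j))"
    using 2 E by (intro neg_mode_Filt) auto
  have b: "psi_right w p j (s + t) \<in> Filt \<bb> (Suc (Suc (wdeg w)) + gdeg m (E i j))" if "i = q"
    using that 2 E by (intro Filt_monoD[OF 2(2)]) (auto simp: basis_simps)
  have c: "psi_right w i q (s + t) \<in> Filt \<bb> (Suc (Suc (wdeg w)) + gdeg m (E i j))" if "j = p"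
    using that 2 E by (intro Filt_monoD[OF 2(3)]) (auto simp: basis_simps)
  have "psi_right ((E i j, t) # w) p q s \<in> Filt \<bb> (Suc (Suc (wdeg w)) + gdeg m (E i j))"
    unfolding psi_right.simps using a b c by (intro Filt_add Filt_diff) (auto simp del: gdeg.simps)
  then show ?case
    by (simp add: algebra_simps del: psi_right.simps gdeg.simps)
qed auto

lemma contr_word_Filt:
  "w \<in> neg_words \<aa> \<Longrightarrow> contr_word w \<in> Filt \<bb> (Suc (wdeg w))"
proof (induction w rule: contr_word.induct)
  case (2 i j t w)
  then have "mode (E i j) (- int t) (contr_word w) \<in> Filt \<bb> (Suc (wdeg w) + gdeg m (E i j))"
    by (intro neg_mode_Filt) (auto simp: E_in_a_basis)
  then show ?case
    by (simp add: algebra_simps del: gdeg.simps)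
next
  case (3 p q s w)
  then show ?case
    using psi_right_Filt[of w p q s] by simp
qed auto

lemma contr_Filt:
  assumes "v \<in> Filt \<aa> p"
  shows "contr v \<in> Filt \<bb> p"
  using assms unfolding Filt_def[of \<aa> p]
proof (induction rule: VS.span_induct_alt)
  case (step c x y)
  then obtain w where w: "x = word w" "w \<in> neg_words \<aa>" "wdeg w < p" by auto
  have "contr x \<in> Filt \<bb> p"
    unfolding w(1) contr_word[OF w(2)] by (rule Filt_monoD[OF contr_word_Filt[OF w(2)]]) (use w in simp)
  then show ?case
    using step by (simp add: contr_add contr_scale Filt_add Filt_scale)
qed simp

text \<open>\<open>psi_right\<close> inserts the new even letter at the right end. Moving it to the
  front, and the odd letter to the back, produces only brackets, which have lower degree. So in
  leading degree contracting an odd letter in front of an even word means replacing it by its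
  preimage.\<close>

lemma psi_right_approx:
  assumes "w \<in> neg_words \<bb>" "Psi p q \<in> \<aa>" "1 \<le> s"
  shows "psi_right w p q s - mode (E (p - n) q) (- int s) (word w) \<in> Filt \<bb> (Suc (wdeg w))"
  using assms
proof (induction w)
  case (Cons l w)
  obtain i j t where l: "l = (E i j, t)"
    using Cons.prems by (cases l; cases "fst l") auto
  have E: "E i j \<in> \<bb>" "1 \<le> t" "w \<in> neg_words \<bb>" "w \<in> neg_words \<aa>"
    using Cons.prems neg_words_b_a[of w m n] by (auto simp: l)
  define e where "e = E (p - n) q"
  have e: "e \<in> \<bb>" "gdeg m e = 1"
    using Cons.prems n_le_m by (auto simp: e_def basis_simps col_def)
  let ?d = "gdeg m (E i j)"
  have a: "mode (E i j) (- int t) (psi_right w p q s - mode e (- int s) (word w))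
       \<in> Filt \<bb> (Suc (wdeg w) + ?d)"
    using Cons E unfolding e_def by (intro neg_mode_Filt) auto
  have b: "psi_right w p j (s + t) \<in> Filt \<bb> (Suc (wdeg w) + ?d)" if "i = q"
    using that Cons.prems E by (intro Filt_monoD[OF psi_right_Filt]) (auto simp: basis_simps)
  have c: "psi_right w i q (s + t) \<in> Filt \<bb> (Suc (wdeg w) + ?d)" if "j = p"
    using that Cons.prems E by (intro Filt_monoD[OF psi_right_Filt]) (auto simp: basis_simps)
  \<comment> \<open>The letter \<open>e\<close> has degree 1, so a bracket with it has degree at
    most that of \<open>E i j\<close>.\<close>
  have "lext (\<lambda>z. mode z (- int (t + s)) (word w)) (a_bracket (E i j) e) \<in> Filt \<bb> (Suc (wdeg w) + ?d)"
  proof (intro VS.lin_ext_in_subspace subspace_Filt)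
    fix z assume "z \<in> Poly_Mapping.keys (a_bracket (E i j) e)"
    then have z: "z \<in> \<bb>" "gdeg m z \<le> ?d"
      using keys_a_bracket[of "E i j" m n e z] E e subsetD[OF b_subset_a, of _ m n]
      by (simp_all del: gdeg.simps)
    have "mode z (- int (t + s)) (word w) \<in> Filt \<bb> (Suc (wdeg w) + gdeg m z)"
      using E z by (intro neg_mode_Filt Filt_word) auto
    then show "mode z (- int (t + s)) (word w) \<in> Filt \<bb> (Suc (wdeg w) + ?d)"
      by (rule Filt_monoD) (use z in simp)
  qed
  moreover have "mode (E i j) (- int t) (mode e (- int s) (word w))
      = mode e (- int s) (mode (E i j) (- int t) (word w))
        + lext (\<lambda>z. mode z (- int (t + s)) (word w)) (a_bracket (E i j) e)"
    using mode_commute_neg[of "E i j" e t s "word w"] E subsetD[OF b_subset_a, of _ m n] e(1)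
    by (simp add: koszul_sign_def e_def del: a_bracket.simps)
  ultimately have d: "mode (E i j) (- int t) (mode e (- int s) (word w))
      - mode e (- int s) (mode (E i j) (- int t) (word w)) \<in> Filt \<bb> (Suc (wdeg w) + ?d)"
    by simp
  have "psi_right (l # w) p q s - mode e (- int s) (word (l # w)) =
     mode (E i j) (- int t) (psi_right w p q s - mode e (- int s) (word w))
     + (mode (E i j) (- int t) (mode e (- int s) (word w))
         - mode e (- int s) (mode (E i j) (- int t) (word w)))
     + (if i = q then psi_right w p j (s + t) else 0) - (if j = p then psi_right w i q (s + t) else 0)"
    by (simp add: l word_Cons nprod_diff_right)
  also have "\<dots> \<in> Filt \<bb> (Suc (wdeg w) + ?d)"
    using b c by (intro Filt_diff[OF Filt_add[OF Filt_add[OF a d]]]) (auto simp del: gdeg.simps)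
  finally show ?case
    by (simp add: l e_def algebra_simps del: gdeg.simps psi_right.simps)
qed simp

lemma contr_Psi_approx:
  assumes "v \<in> Filt \<bb> r" "Psi p q \<in> \<aa>" "1 \<le> s"
  shows "contr (mode (Psi p q) (- int s) v) - mode (E (p - n) q) (- int s) v \<in> Filt \<bb> r"
  using assms(1) unfolding Filt_def[of \<bb> r]
proof (induction rule: VS.span_induct_alt)
  case (step c x y)
  then obtain w where w: "x = word w" "w \<in> neg_words \<bb>" "wdeg w < r" by auto
  have wa: "w \<in> neg_words \<aa>"
    using w(2) by (rule neg_words_b_a)
  let ?f = "\<lambda>v. contr (mode (Psi p q) (- int s) v) - mode (E (p - n) q) (- int s) v"
  have "?f x \<in> Filt \<bb> r"
    unfolding w(1) contr_mode_Psi[OF assms(2,3) wa]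
    by (rule Filt_monoD[OF psi_right_approx]) (use w assms in auto)
  moreover have "?f (smult V c x + y) = smult V c (?f x) + ?f y"
    by (simp add: nprod_add_right nprod_scale_right contr_add contr_scale VS.scale_right_diff_distrib)
  moreover have "?f y \<in> Filt \<bb> r"
    using step.IH unfolding Filt_def .
  ultimately show ?case
    unfolding Filt_def[symmetric] by (simp only: Filt_add Filt_scale)
qed (simp add: VS.span_zero)


section \<open>The derivation and the generators\<close>

abbreviation "VB \<equiv> Vb m n V \<iota>"

lemma subspace_VB: "VS.subspace VB"
  by (simp add: Vb_def)

lemma Filt_b_VB: "v \<in> Filt \<bb> p \<Longrightarrow> v \<in> VB"
  unfolding Vb_def using Filt_subset_span by blast

lemma d0_add: "a \<in> VB \<Longrightarrow> b \<in> VB \<Longrightarrow> d0 (a + b) = d0 a + d0 b"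
  and d0_scale: "a \<in> VB \<Longrightarrow> d0 (smult V c a) = smult V c (d0 a)"
  and d0_nprod: "a \<in> VB \<Longrightarrow> b \<in> VB \<Longrightarrow> d0 (nprod V a k b) = nprod V (d0 a) k b + nprod V a k (d0 b)"
  and d0_vac: "d0 (vac V) = 0"
  and d0_transl: "a \<in> VB \<Longrightarrow> d0 (transl V a) = transl V (d0 a)"
  and d0_E: "E i j \<in> \<bb> \<Longrightarrow> d0 (aff V \<iota> (E i j) 1) = d0_gen m n \<alpha>2 V \<iota> i j"
  using d0 unfolding is_d0_def by blast+

lemma d0_zero: "d0 0 = 0"
  using d0_scale[of 0 0] VS.subspace_0[OF subspace_VB] by simp

lemma d0_diff: "a \<in> VB \<Longrightarrow> b \<in> VB \<Longrightarrow> d0 (a - b) = d0 a - d0 b"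
  using d0_add[of "a - b" b] VS.subspace_diff[OF subspace_VB, of a b] by simp

lemma d0_sum: "finite I \<Longrightarrow> (\<And>i. i \<in> I \<Longrightarrow> f i \<in> VB) \<Longrightarrow> d0 (\<Sum>i\<in>I. f i) = (\<Sum>i\<in>I. d0 (f i))"
proof (induction rule: finite_induct)
  case (insert x F)
  then show ?case
    using VS.subspace_sum[OF subspace_VB, of F f] by (simp add: d0_add)
qed (simp add: d0_zero)

lemma aff_1: "aff V \<iota> x 1 = \<iota> x"
  by (simp add: aff_def creation)

lemma aff_1': "aff V \<iota> x (Suc 0) = \<iota> x"
  using aff_1 by simp

lemma aff_2: "aff V \<iota> x 2 = transl V (\<iota> x)"
  by (simp add: aff_def transl_eq)

lemma gen_Filt: "x \<in> A \<Longrightarrow> \<iota> x \<in> Filt A (Suc (gdeg m x))"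
  using Filt_word[of "[(x, 1)]" A "Suc (gdeg m x)"] by (simp add: word_Cons creation)

lemma gen_VB: "x \<in> \<bb> \<Longrightarrow> \<iota> x \<in> VB"
  using gen_Filt Filt_b_VB by blast

lemma mode_VB: "x \<in> \<bb> \<Longrightarrow> v \<in> VB \<Longrightarrow> mode x k v \<in> VB"
  unfolding Vb_def
  by (erule Filt_exhaust) (use mode_Filt[OF subalg_b] Filt_subset_span in blast)

text \<open>Both sums in \<open>d0_gen\<close> are empty because i and j share a column. For
  \<open>m - n < i\<close> the map from (i, j) to (i + n, j) is a bijection onto the index pairs of
  the odd letters; the contraction inverts it.\<close>

lemma d0_E_upper:
  assumes "i \<in> {1..m}" "j \<in> {1..m}"
  shows "d0 (\<iota> (E i j)) = (if m - n < i then \<iota> (Psi (i + n) j) else 0)"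
proof -
  have [simp]: "{r. Suc 0 \<le> r \<and> r \<le> m + n \<and> col m r < Suc 0 \<and> Suc 0 \<le> col m r} = {}"
    "{r. Suc 0 \<le> r \<and> r \<le> m + n \<and> Suc 0 < col m r \<and> col m r \<le> Suc 0} = {}"
    by auto
  show ?thesis
    using d0_E[of i j] assms by (simp add: E_in_b_basis d0_gen_def col_def aff_1')
qed

lemma d0_E_lower:
  assumes "i \<in> {m<..m+n}" "j \<in> {m<..m+n}"
  shows "d0 (\<iota> (E i j)) = - \<iota> (Psi i (j - n))"
proof -
  have [simp]: "{r. Suc 0 \<le> r \<and> r \<le> m + n \<and> col m r < 2 \<and> 2 \<le> col m r} = {}"
    "{r. Suc 0 \<le> r \<and> r \<le> m + n \<and> 2 < col m r \<and> col m r \<le> 2} = {}"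
    by auto
  have [simp]: "col m i = 2" "col m j = 2" using assms by (auto simp: col_def)
  show ?thesis
    using d0_E[of i j] assms by (simp add: E_in_b_basis d0_gen_def aff_1')
qed

lemma d0_E_mixed:
  assumes "i \<in> {m<..m+n}" "j \<in> {1..m}"
  shows "d0 (\<iota> (E i j)) = (\<Sum>r\<in>{1..m}. mode (E r j) (-1) (\<iota> (Psi i r)))
    - (\<Sum>r\<in>{m<..m+n}. mode (Psi r j) (-1) (\<iota> (E i r))) + smult V \<alpha>2 (transl V (\<iota> (Psi i j)))"
proof -
  have [simp]: "col m i = 2" "col m j = 1" using assms by (auto simp: col_def)
  have "{r. r \<in> {1..m+n} \<and> col m i > col m r \<and> col m r \<ge> col m j} = {1..m}"
    "{r. r \<in> {1..m+n} \<and> col m j < col m r \<and> col m r \<le> col m i} = {m<..m+n}"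
    using assms by (auto simp: col_def split: if_splits)
  then show ?thesis
    using d0_E[of i j] assms by (simp add: E_in_b_basis d0_gen_def aff_1' aff_2)
qed

section \<open>The proposed generators are annihilated by the derivation\<close>

lemma W1_upper:
  assumes "1 \<le> i" "i \<le> m - n" "1 \<le> j" "j \<le> m"
  shows "W1 m n V \<iota> i j = \<iota> (E i j)"
proof -
  have "{(h, l). h \<in> {1..m+n} \<and> l \<in> {1..m+n} \<and> row m n h = i \<and> row m n l = j \<and> col m h = col m l}
      = {(i, j)}"
    using assms by (auto simp: row_def col_def split: if_splits)
  then show ?thesis
    unfolding W1_def by (simp add: aff_1')
qed

lemma W1_lower:
  assumes "m - n < i" "i \<le> m" "m - n < j" "j \<le> m"
  shows "W1 m n V \<iota> i j = \<iota> (E i j) + \<iota> (E (i + n) (j + n))"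
proof -
  have "{(h, l). h \<in> {1..m+n} \<and> l \<in> {1..m+n} \<and> row m n h = i \<and> row m n l = j \<and> col m h = col m l}
      = {(i, j), (i + n, j + n)}"
    using assms by (auto simp: row_def col_def split: if_splits)
  moreover have "(i, j) \<noteq> (i + n, j + n)"
    using assms by auto
  ultimately show ?thesis
    unfolding W1_def by (simp add: aff_1')
qed

lemma W2_eq:
  "W2 m n \<alpha>2 V \<iota> i j = \<iota> (E (i + n) j) - smult V \<alpha>2 (transl V (\<iota> (E i j)))
   + (\<Sum>u\<in>{m-n<..m}. mode (E u j) (-1) (\<iota> (E (i + n) (u + n))))
   - (\<Sum>u\<in>{1..m-n}. mode (E u j) (-1) (\<iota> (E i u)))"
  by (simp add: W2_def aff_1' aff_2)

definition W1_set :: "'v set" where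
  "W1_set = {W1 m n V \<iota> i j |i j. (1 \<le> i \<and> i \<le> m - n \<and> 1 \<le> j \<and> j \<le> m) \<or>
                          (m - n < i \<and> i \<le> m \<and> m - n < j \<and> j \<le> m)}"

definition W2_set :: "'v set" where
  "W2_set = {W2 m n \<alpha>2 V \<iota> i j |i j. m - n < i \<and> i \<le> m \<and> 1 \<le> j \<and> j \<le> m}"

lemma W1_set_cases:
  assumes "a \<in> W1_set"
  obtains i j where "a = \<iota> (E i j)" "i \<in> {1..m-n}" "j \<in> {1..m}"
  | i j where "a = \<iota> (E i j) + \<iota> (E (i + n) (j + n))" "i \<in> {m-n<..m}" "j \<in> {m-n<..m}"
  using assms W1_upper W1_lower unfolding W1_set_def by auto

lemma W1_Filt: "a \<in> W1_set \<Longrightarrow> a \<in> Filt \<bb> 2"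
proof (erule W1_set_cases)
  fix i j assume a: "a = \<iota> (E i j)" "i \<in> {1..m-n}" "j \<in> {1..m}"
  then have "E i j \<in> \<bb>" "gdeg m (E i j) = 1"
    by (auto simp: E_in_b_basis col_def)
  with gen_Filt[of "E i j" \<bb>] show ?thesis
    by (simp add: a numeral_2_eq_2)
next
  fix i j assume a: "a = \<iota> (E i j) + \<iota> (E (i + n) (j + n))" "i \<in> {m-n<..m}" "j \<in> {m-n<..m}"
  then have "E i j \<in> \<bb>" "gdeg m (E i j) = 1" "E (i + n) (j + n) \<in> \<bb>" "gdeg m (E (i + n) (j + n)) = 1"
    by (auto simp: E_in_b_basis col_def)
  with gen_Filt[of "E i j" \<bb>] gen_Filt[of "E (i + n) (j + n)" \<bb>] show ?thesis
    by (simp add: a numeral_2_eq_2 Filt_add)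
qed

lemma d0_W1: "a \<in> W1_set \<Longrightarrow> d0 a = 0"
proof (erule W1_set_cases)
  fix i j assume "a = \<iota> (E i j)" "i \<in> {1..m-n}" "j \<in> {1..m}"
  then show ?thesis
    using d0_E_upper[of i j] by auto
next
  fix i j assume a: "a = \<iota> (E i j) + \<iota> (E (i + n) (j + n))" "i \<in> {m-n<..m}" "j \<in> {m-n<..m}"
  then have "E i j \<in> \<bb>" "E (i + n) (j + n) \<in> \<bb>"
    by (auto simp: E_in_b_basis)
  then show ?thesis
    using d0_E_upper[of i j] d0_E_lower[of "i + n" "j + n"] a by (auto simp: d0_add gen_VB)
qed

lemma W2_terms_b:
  assumes "i \<in> {m-n<..m}" "j \<in> {1..m}"
  shows "E (i + n) j \<in> \<bb>" "E i j \<in> \<bb>" "u \<in> {1..m} \<Longrightarrow> E u j \<in> \<bb>" "u \<in> {1..m} \<Longrightarrow> E i u \<in> \<bb>"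
    "u \<in> {m-n<..m} \<Longrightarrow> E u j \<in> \<bb>" "u \<in> {1..m-n} \<Longrightarrow> E u j \<in> \<bb>" "u \<in> {1..m-n} \<Longrightarrow> E i u \<in> \<bb>"
    "u \<in> {m-n<..m} \<Longrightarrow> E (i + n) (u + n) \<in> \<bb>"
  using assms n_le_m by (auto simp: E_in_b_basis)

lemma gen_transl_VB: "x \<in> \<bb> \<Longrightarrow> transl V (\<iota> x) \<in> VB"
  unfolding transl_eq using Filt_b_VB[OF Filt_word[of "[]" \<bb> 1]] by (auto intro: mode_VB)

lemma W2_VB:
  assumes "a \<in> W2_set"
  shows "a \<in> VB"
proof -
  obtain i j where a: "a = W2 m n \<alpha>2 V \<iota> i j" and ij: "i \<in> {m-n<..m}" "j \<in> {1..m}"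
    using assms by (auto simp: W2_set_def)
  show ?thesis
    unfolding a W2_eq
    by (intro VS.subspace_add[OF subspace_VB] VS.subspace_diff[OF subspace_VB]
      VS.subspace_sum[OF subspace_VB] VS.subspace_scale[OF subspace_VB] mode_VB gen_VB gen_transl_VB
      W2_terms_b[OF ij])
qed

text \<open>The quadratic part of \<open>d0 (\<iota> (E (i + n) j))\<close> cancels against the two
  correction sums: the terms \<open>?P\<close> after splitting \<open>{1..m}\<close> at
  \<open>m - n\<close>, the terms \<open>?Q\<close> after the shift \<open>r = u + n\<close>. The
  derivative term cancels the term with \<open>\<alpha>2\<close>.\<close>

lemma d0_W2:
  assumes "a \<in> W2_set"
  shows "d0 a = 0"
proof -
  obtain i j where a: "a = W2 m n \<alpha>2 V \<iota> i j" and ij: "i \<in> {m-n<..m}" "j \<in> {1..m}"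
    using assms by (auto simp: W2_set_def)
  note b = W2_terms_b[OF ij]
  let ?P = "\<lambda>u. mode (E u j) (-1) (\<iota> (Psi (i + n) u))"
  let ?Q = "\<lambda>u. mode (Psi u j) (-1) (\<iota> (E (i + n) u))"
  have 1: "d0 (\<iota> (E (i + n) j)) = (\<Sum>r\<in>{1..m}. ?P r)
    - (\<Sum>r\<in>{m<..m+n}. ?Q r) + smult V \<alpha>2 (transl V (\<iota> (Psi (i + n) j)))"
    using ij by (intro d0_E_mixed) auto
  have 2: "d0 (smult V \<alpha>2 (transl V (\<iota> (E i j)))) = smult V \<alpha>2 (transl V (\<iota> (Psi (i + n) j)))"
    using ij b d0_E_upper[of i j] by (simp add: d0_scale gen_transl_VB d0_transl gen_VB)
  have 3: "d0 (\<Sum>u\<in>{m-n<..m}. mode (E u j) (-1) (\<iota> (E (i + n) (u + n))))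
     = (\<Sum>u\<in>{m-n<..m}. ?Q (u + n) - ?P u)"
  proof (subst d0_sum)
    show "(\<Sum>u\<in>{m-n<..m}. d0 (mode (E u j) (-1) (\<iota> (E (i + n) (u + n)))))
      = (\<Sum>u\<in>{m-n<..m}. ?Q (u + n) - ?P u)"
    proof (intro sum.cong refl)
      fix u assume u: "u \<in> {m-n<..m}"
      have "d0 (\<iota> (E u j)) = \<iota> (Psi (u + n) j)"
        using u ij d0_E_upper[of u j] by auto
      moreover have "d0 (\<iota> (E (i + n) (u + n))) = - \<iota> (Psi (i + n) u)"
        using u ij d0_E_lower[of "i + n" "u + n"] by auto
      ultimately show "d0 (mode (E u j) (-1) (\<iota> (E (i + n) (u + n)))) = ?Q (u + n) - ?P u"
        using b u by (simp add: d0_nprod gen_VB nprod_neg_right)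
    qed
  qed (use b in \<open>auto intro!: mode_VB gen_VB\<close>)
  have 4: "d0 (\<Sum>u\<in>{1..m-n}. mode (E u j) (-1) (\<iota> (E i u))) = (\<Sum>u\<in>{1..m-n}. ?P u)"
  proof (subst d0_sum)
    show "(\<Sum>u\<in>{1..m-n}. d0 (mode (E u j) (-1) (\<iota> (E i u)))) = (\<Sum>u\<in>{1..m-n}. ?P u)"
    proof (intro sum.cong refl)
      fix u assume u: "u \<in> {1..m-n}"
      have "d0 (\<iota> (E u j)) = 0" "d0 (\<iota> (E i u)) = \<iota> (Psi (i + n) u)"
        using u ij d0_E_upper[of u j] d0_E_upper[of i u] by auto
      then show "d0 (mode (E u j) (-1) (\<iota> (E i u))) = ?P u"
        using b u by (simp add: d0_nprod gen_VB)
    qed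
  qed (use b in \<open>auto intro!: mode_VB gen_VB\<close>)
  have 5: "(\<Sum>r\<in>{m<..m+n}. ?Q r) = (\<Sum>u\<in>{m-n<..m}. ?Q (u + n))"
    using n_le_m by (intro sum.reindex_bij_witness[of _ "\<lambda>u. u + n" "\<lambda>r. r - n"]) auto
  have "{1..m} = {1..m-n} \<union> {m-n<..m}" "{1..m-n} \<inter> {m-n<..m} = {}"
    by auto
  then have 6: "(\<Sum>r\<in>{1..m}. ?P r) = (\<Sum>u\<in>{1..m-n}. ?P u) + (\<Sum>u\<in>{m-n<..m}. ?P u)"
    by (simp add: sum.union_disjoint)
  have mem: "\<iota> (E (i + n) j) \<in> VB" "smult V \<alpha>2 (transl V (\<iota> (E i j))) \<in> VB"
    "(\<Sum>u\<in>{m-n<..m}. mode (E u j) (-1) (\<iota> (E (i + n) (u + n)))) \<in> VB"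
    "(\<Sum>u\<in>{1..m-n}. mode (E u j) (-1) (\<iota> (E i u))) \<in> VB"
    using b by (auto intro!: VS.subspace_sum[OF subspace_VB] VS.subspace_scale[OF subspace_VB]
        mode_VB gen_VB gen_transl_VB)
  have "d0 a = d0 (\<iota> (E (i + n) j)) - d0 (smult V \<alpha>2 (transl V (\<iota> (E i j))))
    + d0 (\<Sum>u\<in>{m-n<..m}. mode (E u j) (-1) (\<iota> (E (i + n) (u + n))))
    - d0 (\<Sum>u\<in>{1..m-n}. mode (E u j) (-1) (\<iota> (E i u)))"
    unfolding a W2_eq using mem
    by (simp add: d0_add d0_diff VS.subspace_add[OF subspace_VB] VS.subspace_diff[OF subspace_VB])
  also have "\<dots> = 0"
    unfolding 1 2 3 4 5 6 by (simp add: sum_subtractf)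
  finally show ?thesis .
qed


text \<open>The part of the mode \<open>(W2 i j)\<^sub>(\<^sub>-\<^sub>s\<^sub>)\<close> built from negative modes of generators only.\<close>

definition W2_neg :: "nat \<Rightarrow> nat \<Rightarrow> nat \<Rightarrow> 'v \<Rightarrow> 'v" where
  "W2_neg i j s v = mode (E (i + n) j) (- int s) v
     - smult V (\<alpha>2 * of_nat s) (mode (E i j) (- int (Suc s)) v)
     + (\<Sum>u\<in>{m-n<..m}. neg_normal (E u j) (E (i + n) (u + n)) s v)
     - (\<Sum>u\<in>{1..m-n}. neg_normal (E u j) (E i u) s v)"

lemma nprod_transl: "nprod V (transl V a) (- int s) v = smult V (of_nat s) (nprod V a (- int (Suc s)) v)"
proof -
  have *: "- int s - 1 = - int (Suc s)" by simp
  show ?thesis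
    unfolding transl_nprod * by simp
qed

context
  fixes i j assumes i: "i \<in> {m-n<..m}" and j: "j \<in> {1..m}"
begin

lemma W2_terms_deg:
  "gdeg m (E (i + n) j) = 2" "gdeg m (E i j) = 1"
  "u \<in> {m-n<..m} \<Longrightarrow> gdeg m (E u j) = 1" "u \<in> {m-n<..m} \<Longrightarrow> gdeg m (E (i + n) (u + n)) = 1"
  "u \<in> {1..m-n} \<Longrightarrow> gdeg m (E u j) = 1" "u \<in> {1..m-n} \<Longrightarrow> gdeg m (E i u) = 1"
  using i j by (auto simp: col_def)

text \<open>Only the quadratic terms differ, by the normal ordering errors. The mode itself raises
  the filtration index by 2, the difference only by 1. The alphabet is left open because both a
  vector over \<aa> and its contraction over \<bb> occur later.\<close>

lemma W2_neg_approx: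
  assumes "subalg A" "\<bb> \<subseteq> A" "v \<in> Filt A p"
  shows "nprod V (W2 m n \<alpha>2 V \<iota> i j) (- int s) v - W2_neg i j s v \<in> Filt A (Suc p)"
proof -
  let ?D = "\<lambda>x y. nprod V (mode x (-1) (\<iota> y)) (- int s) v - neg_normal x y s v"
  have 1: "?D (E u j) (E (i + n) (u + n)) \<in> Filt A (Suc p)" if "u \<in> {m-n<..m}" for u
    using normal_product_Filt[OF assms(1) _ _ assms(3), of "E u j" "E (i + n) (u + n)" s]
      subsetD[OF assms(2)] W2_terms_b[OF i j] W2_terms_deg that by simp
  have 2: "?D (E u j) (E i u) \<in> Filt A (Suc p)" if "u \<in> {1..m-n}" for u
    using normal_product_Filt[OF assms(1) _ _ assms(3), of "E u j" "E i u" s]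
      subsetD[OF assms(2)] W2_terms_b[OF i j] W2_terms_deg that by simp
  have "nprod V (W2 m n \<alpha>2 V \<iota> i j) (- int s) v - W2_neg i j s v =
     (\<Sum>u\<in>{m-n<..m}. ?D (E u j) (E (i + n) (u + n))) - (\<Sum>u\<in>{1..m-n}. ?D (E u j) (E i u))"
    unfolding W2_eq W2_neg_def nprod_add_left nprod_diff_left nprod_scale_left nprod_sum_left
      nprod_transl VS.scale_scale sum_subtractf
    by (simp add: algebra_simps)
  also have "\<dots> \<in> Filt A (Suc p)"
    by (rule Filt_diff[OF Filt_sum Filt_sum]) (erule 1 2)+
  finally show ?thesis .
qed

lemma W2_neg_Filt:
  assumes "\<bb> \<subseteq> A" "v \<in> Filt A p" "1 \<le> s"
  shows "W2_neg i j s v \<in> Filt A (p + 2)"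
proof -
  note b = subsetD[OF assms(1) W2_terms_b(1)[OF i j]] subsetD[OF assms(1) W2_terms_b(2)[OF i j]]
  have "mode (E (i + n) j) (- int s) v \<in> Filt A (p + 2)"
    using neg_mode_Filt[OF b(1) _ assms(2), of "- int s"] assms(3) unfolding W2_terms_deg by simp
  moreover have "mode (E i j) (- int (Suc s)) v \<in> Filt A (p + 2)"
    using neg_mode_Filt[OF b(2) _ assms(2), of "- int (Suc s)"] unfolding W2_terms_deg
    by (rule Filt_monoD) auto
  moreover have "neg_normal (E u j) (E (i + n) (u + n)) s v \<in> Filt A (p + 2)" if "u \<in> {m-n<..m}" for u
    using neg_normal_Filt[OF _ _ assms(2), of "E u j" "E (i + n) (u + n)" s]
      subsetD[OF assms(1)] W2_terms_b[OF i j] W2_terms_deg that by simp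
  moreover have "neg_normal (E u j) (E i u) s v \<in> Filt A (p + 2)" if "u \<in> {1..m-n}" for u
    using neg_normal_Filt[OF _ _ assms(2), of "E u j" "E i u" s]
      subsetD[OF assms(1)] W2_terms_b[OF i j] W2_terms_deg that by simp
  ultimately show ?thesis
    unfolding W2_neg_def by (intro Filt_diff Filt_add Filt_sum Filt_scale)
qed

lemma W2_mode_Filt:
  assumes "subalg A" "\<bb> \<subseteq> A" "v \<in> Filt A p" "1 \<le> s"
  shows "nprod V (W2 m n \<alpha>2 V \<iota> i j) (- int s) v \<in> Filt A (p + 2)"
proof -
  have "nprod V (W2 m n \<alpha>2 V \<iota> i j) (- int s) v - W2_neg i j s v \<in> Filt A (p + 2)"
    using W2_neg_approx[OF assms(1-3), of s] by (rule Filt_monoD) simp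
  from Filt_add[OF this W2_neg_Filt[OF assms(2-4)]] show ?thesis
    by simp
qed

lemma contr_neg_normal:
  assumes "E a b \<in> \<bb>" "E c d \<in> \<bb>"
  shows "contr (neg_normal (E a b) (E c d) s v) = neg_normal (E a b) (E c d) s (contr v)"
  unfolding neg_normal_def contr_sum using assms by (intro sum.cong refl) (simp add: contr_mode_E)

text \<open>All modes in \<open>W2_neg\<close> are negative modes of even letters, each of which
  commutes with \<open>contr\<close>.\<close>

lemma contr_W2_neg:
  assumes "1 \<le> s"
  shows "contr (W2_neg i j s v) = W2_neg i j s (contr v)"
proof -
  have 1: "(\<Sum>u\<in>{m-n<..m}. contr (neg_normal (E u j) (E (i + n) (u + n)) s v))
      = (\<Sum>u\<in>{m-n<..m}. neg_normal (E u j) (E (i + n) (u + n)) s (contr v))"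
    using W2_terms_b[OF i j] by (intro sum.cong refl contr_neg_normal)
  have 2: "(\<Sum>u\<in>{1..m-n}. contr (neg_normal (E u j) (E i u) s v))
      = (\<Sum>u\<in>{1..m-n}. neg_normal (E u j) (E i u) s (contr v))"
    using W2_terms_b[OF i j] by (intro sum.cong refl contr_neg_normal)
  show ?thesis
    unfolding W2_neg_def contr_add contr_diff contr_scale contr_sum 1 2
    using W2_terms_b[OF i j] assms by (simp add: contr_mode_E)
qed

text \<open>Nonnegative modes need not commute with \<^const>\<open>contr\<close>, but they lower the filtration degree.\<close>

lemma contr_W2_approx:
  assumes "z \<in> Filt \<aa> p" "1 \<le> s"
  shows "contr (nprod V (W2 m n \<alpha>2 V \<iota> i j) (- int s) z)
      - nprod V (W2 m n \<alpha>2 V \<iota> i j) (- int s) (contr z) \<in> Filt \<bb> (Suc p)"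
proof -
  let ?W = "nprod V (W2 m n \<alpha>2 V \<iota> i j) (- int s)"
  \<comment> \<open>The error of the first mode is estimated over \<aa> and then carried to \<bb> by
    \<open>contr\<close>, that of the second directly over \<bb>; the parts with
    \<open>W2_neg\<close> cancel.\<close>
  have "contr (?W z - W2_neg i j s z) - (?W (contr z) - W2_neg i j s (contr z)) \<in> Filt \<bb> (Suc p)"
    by (intro Filt_diff contr_Filt W2_neg_approx subalg_a subalg_b order_refl b_subset_a assms)
  then show ?thesis
    using assms(2) by (simp add: contr_diff contr_W2_neg)
qed

end

section \<open>Words in the generators and the remaining letters\<close>

text \<open>
  \<open>mixed_word p r v\<close>: the vector \<open>v\<close> is a word of degree \<open>p\<close> in the generators of the
  W-algebra and the letters \<open>E i j\<close>, \<open>m - n < i\<close>, with exactly \<open>r\<close> letters of the latter kind.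
\<close>

inductive mixed_word :: "nat \<Rightarrow> nat \<Rightarrow> 'v \<Rightarrow> bool" where
  vac: "mixed_word 0 0 (vac V)"
| W1: "a \<in> W1_set \<Longrightarrow> 1 \<le> s \<Longrightarrow> mixed_word p r v \<Longrightarrow> mixed_word (Suc p) r (nprod V a (- int s) v)"
| W2: "a \<in> W2_set \<Longrightarrow> 1 \<le> s \<Longrightarrow> mixed_word p r v \<Longrightarrow> mixed_word (p + 2) r (nprod V a (- int s) v)"
| E: "i \<in> {m-n<..m} \<Longrightarrow> j \<in> {1..m} \<Longrightarrow> 1 \<le> s \<Longrightarrow> mixed_word p r v \<Longrightarrow>
    mixed_word (Suc p) (Suc r) (mode (E i j) (- int s) v)"

lemma W2_setE:
  assumes "a \<in> W2_set"
  obtains i j where "a = W2 m n \<alpha>2 V \<iota> i j" "i \<in> {m-n<..m}" "j \<in> {1..m}"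
  using assms by (auto simp: W2_set_def)

lemma W1_mode_Filt:
  assumes "a \<in> W1_set" "1 \<le> s" "\<bb> \<subseteq> A" "v \<in> Filt A p"
  shows "nprod V a (- int s) v \<in> Filt A (Suc p)"
  using assms(1)
proof (cases rule: W1_set_cases)
  case (1 i j)
  then have "E i j \<in> \<bb>" "gdeg m (E i j) = 1"
    by (auto simp: E_in_b_basis col_def)
  with neg_mode_Filt[OF _ _ assms(4), of "E i j" "- int s"] assms(2,3) show ?thesis
    by (auto simp: 1(1))
next
  case (2 i j)
  then have "E i j \<in> \<bb>" "gdeg m (E i j) = 1" "E (i + n) (j + n) \<in> \<bb>" "gdeg m (E (i + n) (j + n)) = 1"
    by (auto simp: E_in_b_basis col_def)
  moreover from this have "E i j \<in> A" "E (i + n) (j + n) \<in> A"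
    using assms(3) by blast+
  moreover note neg_mode_Filt[OF _ _ assms(4), of "E i j" "- int s"]
    neg_mode_Filt[OF _ _ assms(4), of "E (i + n) (j + n)" "- int s"]
  ultimately show ?thesis
    using assms(2) by (simp add: 2(1) nprod_add_left Filt_add)
qed

text \<open>Unlike for the quadratic generators this is exact, since an element of
  \<open>W1_set\<close> is a sum of letters.\<close>

lemma contr_W1:
  assumes "a \<in> W1_set" "1 \<le> s"
  shows "contr (nprod V a (- int s) v) = nprod V a (- int s) (contr v)"
  using assms(1)
proof (cases rule: W1_set_cases)
  case (1 i j)
  then have "E i j \<in> \<bb>" by (auto simp: E_in_b_basis)
  then show ?thesis using assms(2) by (simp add: 1(1) contr_mode_E)
next
  case (2 i j)
  then have "E i j \<in> \<bb>" "E (i + n) (j + n) \<in> \<bb>" by (auto simp: E_in_b_basis)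
  then show ?thesis using assms(2) by (simp add: 2(1) contr_mode_E nprod_add_left contr_add)
qed

lemma E_letter:
  assumes "i \<in> {m-n<..m}" "j \<in> {1..m}"
  shows "E i j \<in> \<bb>" "gdeg m (E i j) = 1" "Psi (i + n) j \<in> \<aa>" "d0 (\<iota> (E i j)) = \<iota> (Psi (i + n) j)"
proof -
  show "d0 (\<iota> (E i j)) = \<iota> (Psi (i + n) j)"
    using d0_E_upper[of i j] assms by auto
qed (use assms in \<open>auto simp: basis_simps col_def\<close>)

lemma mixed_word_Filt: "mixed_word p r v \<Longrightarrow> v \<in> Filt \<bb> (Suc p)"
proof (induction rule: mixed_word.induct)
  case vac
  show ?case using Filt_word[of "[]" \<bb> 1] by simp
next
  case (W1 a s p r v)
  then show ?case by (intro W1_mode_Filt) auto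
next
  case (W2 a s p r v)
  then show ?case
    using W2_mode_Filt[OF _ _ subalg_b order_refl, of _ _ v "Suc p" s] by (auto elim!: W2_setE)
next
  case (E i j s p r v)
  then show ?case
    using neg_mode_Filt[OF E_letter(1), of i j "- int s" v "Suc p"] E_letter(2)[of i j] by simp
qed

lemma Filt_b_a: "Filt \<bb> p \<subseteq> Filt \<aa> p"
  unfolding Filt_def by (intro VS.span_mono image_mono) (auto intro: neg_words_b_a)

lemma mixed_word_VB: "mixed_word p r v \<Longrightarrow> v \<in> VB"
  using mixed_word_Filt Filt_b_VB by blast

lemma W1_VB: "a \<in> W1_set \<Longrightarrow> a \<in> VB"
  using W1_Filt Filt_b_VB by blast

lemma d0_W1_mode: "a \<in> W1_set \<Longrightarrow> v \<in> VB \<Longrightarrow> d0 (nprod V a k v) = nprod V a k (d0 v)"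
  by (simp add: d0_nprod W1_VB d0_W1)

lemma d0_W2_mode: "a \<in> W2_set \<Longrightarrow> v \<in> VB \<Longrightarrow> d0 (nprod V a k v) = nprod V a k (d0 v)"
  by (simp add: d0_nprod W2_VB d0_W2)

text \<open>The derivation commutes with the modes of the generators and turns each letter
  \<open>E i j\<close> into an odd letter of the same degree 1.\<close>

lemma mixed_word_d0_Filt: "mixed_word p r v \<Longrightarrow> d0 v \<in> Filt \<aa> (Suc p)"
proof (induction rule: mixed_word.induct)
  case vac
  show ?case by (simp add: d0_vac)
next
  case (W1 a s p r v)
  then show ?case
    using b_subset_a by (simp add: d0_W1_mode mixed_word_VB W1_mode_Filt)
next
  case (W2 a s p r v)
  then obtain i j where "a = W2 m n \<alpha>2 V \<iota> i j" "i \<in> {m-n<..m}" "j \<in> {1..m}"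
    by (elim W2_setE)
  then show ?case
    using W2 W2_mode_Filt[OF _ _ subalg_a b_subset_a, of i j "d0 v" "Suc p" s]
    by (simp add: d0_W2_mode mixed_word_VB)
next
  case (E i j s p r v)
  note e = E_letter[OF E.hyps(1,2)]
  have "v \<in> Filt \<aa> (Suc p)"
    using mixed_word_Filt[OF E.hyps(4)] Filt_b_a by blast
  then have "mode (Psi (i + n) j) (- int s) v \<in> Filt \<aa> (Suc p + 1)"
    using neg_mode_Filt[OF e(3), of "- int s" v "Suc p"] E.hyps by simp
  moreover have "mode (E i j) (- int s) (d0 v) \<in> Filt \<aa> (Suc p + 1)"
    using neg_mode_Filt[OF subsetD[OF b_subset_a e(1)], of "- int s" "d0 v" "Suc p"] E e(2) by simp
  ultimately show ?case
    using e E.hyps by (simp add: d0_nprod gen_VB mixed_word_VB Filt_add)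
qed

text \<open>
  Modulo lower filtration degree, \<open>contr \<circ> d0\<close> is the Euler operator counting the letters \<open>E i j\<close>.
\<close>

lemma contr_d0_mixed_word:
  "mixed_word p r v \<Longrightarrow> contr (d0 v) - smult V (of_nat r) v \<in> Filt \<bb> p"
proof (induction rule: mixed_word.induct)
  case vac
  show ?case by (simp add: d0_vac)
next
  case (W1 a s p r v)
  have "contr (d0 (nprod V a (- int s) v)) - smult V (of_nat r) (nprod V a (- int s) v)
     = nprod V a (- int s) (contr (d0 v) - smult V (of_nat r) v)"
    using W1 by (simp add: d0_W1_mode mixed_word_VB contr_W1 nprod_diff_right nprod_scale_right)
  also have "\<dots> \<in> Filt \<bb> (Suc p)"
    using W1 by (intro W1_mode_Filt) auto
  finally show ?case .
next
  case (W2 a s p r v)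
  then obtain i j where a: "a = W2 m n \<alpha>2 V \<iota> i j" "i \<in> {m-n<..m}" "j \<in> {1..m}"
    by (elim W2_setE)
  \<comment> \<open>The derivation passes the quadratic generator exactly, the contraction only up
    to lower degree.\<close>
  have 1: "contr (nprod V a (- int s) (d0 v)) - nprod V a (- int s) (contr (d0 v)) \<in> Filt \<bb> (p + 2)"
    using contr_W2_approx[OF a(2,3) mixed_word_d0_Filt, of p r v s] W2 a by simp
  have 2: "nprod V a (- int s) (contr (d0 v) - smult V (of_nat r) v) \<in> Filt \<bb> (p + 2)"
    using W2_mode_Filt[OF a(2,3) subalg_b order_refl W2.IH, of s] W2.hyps a by simp
  have "contr (d0 (nprod V a (- int s) v)) - smult V (of_nat r) (nprod V a (- int s) v)
     = (contr (nprod V a (- int s) (d0 v)) - nprod V a (- int s) (contr (d0 v)))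
       + nprod V a (- int s) (contr (d0 v) - smult V (of_nat r) v)"
    using W2 by (simp add: d0_W2_mode mixed_word_VB nprod_diff_right nprod_scale_right)
  also have "\<dots> \<in> Filt \<bb> (p + 2)"
    using 1 2 by (rule Filt_add)
  finally show ?case .
next
  case (E i j s p r v)
  note e = E_letter[OF E.hyps(1,2)]
  \<comment> \<open>The image of the new letter contracts back to that letter; this raises the
    eigenvalue from r to \<open>Suc r\<close>.\<close>
  have 1: "contr (mode (Psi (i + n) j) (- int s) v) - mode (E i j) (- int s) v \<in> Filt \<bb> (Suc p)"
    using contr_Psi_approx[OF mixed_word_Filt[OF E.hyps(4)] e(3) E.hyps(3)] by simp
  have 2: "mode (E i j) (- int s) (contr (d0 v) - smult V (of_nat r) v) \<in> Filt \<bb> (Suc p)"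
    using neg_mode_Filt[OF e(1) _ E.IH, of "- int s"] E.hyps e(2) by simp
  have "contr (d0 (mode (E i j) (- int s) v)) - smult V (of_nat (Suc r)) (mode (E i j) (- int s) v)
     = (contr (mode (Psi (i + n) j) (- int s) v) - mode (E i j) (- int s) v)
       + mode (E i j) (- int s) (contr (d0 v) - smult V (of_nat r) v)"
    using E.hyps e mixed_word_VB[OF E.hyps(4)]
    by (simp add: d0_nprod gen_VB contr_add contr_mode_E nprod_diff_right nprod_scale_right
        VS.scale_left_distrib)
  also have "\<dots> \<in> Filt \<bb> (Suc p)"
    using 1 2 by (rule Filt_add)
  finally show ?case .
qed

section \<open>Mixed words span each filtration step\<close>

definition Mixed :: "nat \<Rightarrow> 'v set" where
  "Mixed p = VS.span {v. \<exists>q r. q < p \<and> mixed_word q r v}"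

lemma subspace_Mixed [simp, intro]: "VS.subspace (Mixed p)"
  by (simp add: Mixed_def)

lemma Mixed_monoD: "v \<in> Mixed p \<Longrightarrow> p \<le> q \<Longrightarrow> v \<in> Mixed q"
  unfolding Mixed_def by (erule subsetD[OF VS.span_mono, rotated]) (blast intro: less_le_trans)

lemmas Mixed_add = VS.subspace_add[OF subspace_Mixed]
  and Mixed_diff = VS.subspace_diff[OF subspace_Mixed]
  and Mixed_scale = VS.subspace_scale[OF subspace_Mixed]
  and Mixed_sum = VS.subspace_sum[OF subspace_Mixed]

lemma Mixed_closed:
  assumes "v \<in> Mixed p" "\<And>q r w. mixed_word q r w \<Longrightarrow> \<exists>r'. mixed_word (q + d) r' (nprod V a k w)"
  shows "nprod V a k v \<in> Mixed (p + d)"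
  using assms(1) unfolding Mixed_def[of p]
proof (rule nprod_maps_span)
  fix w assume "w \<in> {v. \<exists>q r. q < p \<and> mixed_word q r v}"
  then obtain q r where "q < p" "mixed_word q r w" by auto
  moreover from assms(2)[OF this(2)] obtain r' where "mixed_word (q + d) r' (nprod V a k w)" ..
  ultimately show "nprod V a k w \<in> Mixed (p + d)"
    unfolding Mixed_def by (intro VS.span_base CollectI exI[of _ "q + d"] exI[of _ r'] conjI) auto
qed simp

lemma W1_Mixed:
  assumes "a \<in> W1_set" "1 \<le> s" "v \<in> Mixed p"
  shows "nprod V a (- int s) v \<in> Mixed (Suc p)"
proof -
  have "nprod V a (- int s) v \<in> Mixed (p + 1)"
    using assms(3) by (rule Mixed_closed) (use mixed_word.W1[OF assms(1,2)] in auto)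
  then show ?thesis by simp
qed

lemma W2_Mixed: "a \<in> W2_set \<Longrightarrow> 1 \<le> s \<Longrightarrow> v \<in> Mixed p \<Longrightarrow> nprod V a (- int s) v \<in> Mixed (p + 2)"
  using Mixed_closed[of v p 2 a "- int s"] mixed_word.W2 by blast

lemma E_Mixed:
  assumes "E i j \<in> \<bb>" "col m i = col m j" "1 \<le> s" "v \<in> Mixed p"
  shows "mode (E i j) (- int s) v \<in> Mixed (Suc p)"
proof -
  have letter: "mode (E i j) (- int s) v \<in> Mixed (Suc p)" if "i \<in> {m-n<..m}" "j \<in> {1..m}" for i j
  proof -
    have "mode (E i j) (- int s) v \<in> Mixed (p + 1)"
      using assms(4) by (rule Mixed_closed) (use mixed_word.E[OF that assms(3)] in auto)
    then show ?thesis by simp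
  qed
  have ij: "i \<in> {1..m+n}" "j \<in> {1..m+n}" "i \<le> m \<longleftrightarrow> j \<le> m"
    using same_col[OF assms(1,2)] by blast+
  consider "i \<in> {1..m-n}" "j \<in> {1..m}" | "i \<in> {m-n<..m}" "j \<in> {1..m}"
    | "i \<in> {m<..m+n}" "j \<in> {m<..m+n}"
    using ij by (cases "i \<le> m"; cases "i \<le> m - n") auto
  then show ?thesis
  proof cases
    case 1
    then have "\<iota> (E i j) \<in> W1_set"
      using W1_upper[of i j] unfolding W1_set_def by force
    then show ?thesis
      using assms by (intro W1_Mixed)
  next
    case 2
    then show ?thesis by (rule letter)
  next
    case 3
    define i' j' where "i' = i - n" and "j' = j - n"
    have ij: "i = i' + n" "j = j' + n" "i' \<in> {m-n<..m}" "j' \<in> {m-n<..m}"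
      using 3 n_le_m by (auto simp: i'_def j'_def)
    then have "\<iota> (E i' j') + \<iota> (E i j) \<in> W1_set"
      using W1_lower[of i' j'] unfolding W1_set_def by force
    then have "nprod V (\<iota> (E i' j') + \<iota> (E i j)) (- int s) v \<in> Mixed (Suc p)"
      using assms by (intro W1_Mixed)
    moreover have "mode (E i' j') (- int s) v \<in> Mixed (Suc p)"
      using ij by (intro letter) auto
    ultimately have "nprod V (\<iota> (E i' j') + \<iota> (E i j)) (- int s) v - mode (E i' j') (- int s) v \<in> Mixed (Suc p)"
      by (rule Mixed_diff)
    then show ?thesis by (simp add: nprod_add_left)
  qed
qed

lemma neg_normal_Mixed:
  assumes "E a b \<in> \<bb>" "E c d \<in> \<bb>" "gdeg m (E a b) = 1" "gdeg m (E c d) = 1" "v \<in> Mixed p"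
  shows "neg_normal (E a b) (E c d) s v \<in> Mixed (p + 2)"
  unfolding neg_normal_def
proof (rule Mixed_sum)
  fix k assume k: "k \<in> {..<s}"
  have col: "col m a = col m b" "col m c = col m d"
    using assms(3,4) by (blast intro: gdeg_1_same_col)+
  have "mode (E c d) (- int (s - k)) v \<in> Mixed (Suc p)"
    using k assms(2,5) col by (intro E_Mixed) auto
  then have "mode (E a b) (- int (Suc k)) (mode (E c d) (- int (s - k)) v) \<in> Mixed (Suc (Suc p))"
    using E_Mixed[OF assms(1) col(1), of "Suc k"] by simp
  then show "mode (E a b) (- int (Suc k)) (mode (E c d) (- int (s - k)) v) \<in> Mixed (p + 2)"
    by simp
qed

text \<open>The definition solved for its leading term: a letter of degree 2 becomes a generator
  mode, up to an error of lower degree and terms with letters of degree 1.\<close>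

lemma W2_neg_solve:
  "mode (E (i + n) j) (- int s) v = nprod V (W2 m n \<alpha>2 V \<iota> i j) (- int s) v
     - (nprod V (W2 m n \<alpha>2 V \<iota> i j) (- int s) v - W2_neg i j s v)
     + smult V (\<alpha>2 * of_nat s) (mode (E i j) (- int (Suc s)) v)
     - (\<Sum>u\<in>{m-n<..m}. neg_normal (E u j) (E (i + n) (u + n)) s v)
     + (\<Sum>u\<in>{1..m-n}. neg_normal (E u j) (E i u) s v)"
  by (simp add: W2_neg_def)

text \<open>Induction on the degree, replacing the first letter of a word. The tail has smaller
  degree because letters have positive degree.\<close>

lemma Filt_subset_Mixed: "Filt \<bb> p \<subseteq> Mixed p"
proof (induction p rule: less_induct)
  case (less p)
  have "word w \<in> Mixed p" if w: "w \<in> neg_words \<bb>" "wdeg w < p" for w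
  proof (cases w)
    case Nil
    then show ?thesis
      using w mixed_word.vac unfolding Mixed_def by (intro VS.span_base) auto
  next
    case (Cons l w')
    then obtain i j s where l: "l = (E i j, s)"
      using w by (cases l; cases "fst l") auto
    have E: "E i j \<in> \<bb>" "1 \<le> s" "w' \<in> neg_words \<bb>"
      using w by (auto simp: Cons l)
    define v where "v = word w'"
    have eq: "word w = mode (E i j) (- int s) v"
      by (simp add: Cons l v_def word_Cons)
    have F: "v \<in> Filt \<bb> (Suc (wdeg w'))"
      unfolding v_def using E by (intro Filt_word) auto
    have deg: "gdeg m (E i j) + wdeg w' < p"
      using w by (auto simp: Cons l simp del: gdeg.simps)
    show ?thesis
    proof (cases "col m i = col m j")
      case True
      then have "v \<in> Mixed (Suc (wdeg w'))" if "Suc (wdeg w') < p"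
        using less.IH[OF that] F by blast
      moreover have "Suc (wdeg w') < p"
        using deg True by simp
      ultimately have "mode (E i j) (- int s) v \<in> Mixed (Suc (Suc (wdeg w')))"
        using E True by (intro E_Mixed) auto
      then show ?thesis
        unfolding eq by (rule Mixed_monoD) (use deg True in simp)
    next
      case False
      then have d: "wdeg w' + 2 < p" using deg by simp
      define i' where "i' = i - n"
      have ij: "i = i' + n" "i' \<in> {m-n<..m}" "j \<in> {1..m}"
        using E(1) False n_le_m by (auto simp: E_in_b_basis col_def i'_def split: if_splits)
      note b = W2_terms_b[OF ij(2,3)] and dg = W2_terms_deg[OF ij(2,3)]
      have v: "v \<in> Mixed (Suc (wdeg w'))"
        using less.IH[of "Suc (wdeg w')"] F d by auto
      have "W2 m n \<alpha>2 V \<iota> i' j \<in> W2_set"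
        using ij unfolding W2_set_def by auto
      then have 1: "nprod V (W2 m n \<alpha>2 V \<iota> i' j) (- int s) v \<in> Mixed (Suc (wdeg w') + 2)"
        using E v by (intro W2_Mixed)
      \<comment> \<open>This error is not visibly a mixed expression, but its degree is low enough
        for the induction hypothesis.\<close>
      have "nprod V (W2 m n \<alpha>2 V \<iota> i' j) (- int s) v - W2_neg i' j s v \<in> Filt \<bb> (Suc (Suc (wdeg w')))"
        using W2_neg_approx[OF ij(2,3) subalg_b order_refl F] .
      then have 2: "nprod V (W2 m n \<alpha>2 V \<iota> i' j) (- int s) v - W2_neg i' j s v \<in> Mixed (Suc (wdeg w') + 2)"
        using less.IH[of "Suc (Suc (wdeg w'))"] d by (auto intro: Mixed_monoD[of _ "Suc (Suc (wdeg w'))"])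
      have 3: "mode (E i' j) (- int (Suc s)) v \<in> Mixed (Suc (wdeg w') + 2)"
        using b(2) ij by (intro Mixed_monoD[OF E_Mixed[OF _ _ _ v]]) (auto simp: col_def)
      have 4: "neg_normal (E u j) (E (i' + n) (u + n)) s v \<in> Mixed (Suc (wdeg w') + 2)"
        if "u \<in> {m-n<..m}" for u
        using that b dg v by (intro neg_normal_Mixed)
      have 5: "neg_normal (E u j) (E i' u) s v \<in> Mixed (Suc (wdeg w') + 2)"
        if "u \<in> {1..m-n}" for u
        using that b dg v by (intro neg_normal_Mixed)
      have "mode (E i j) (- int s) v \<in> Mixed (Suc (wdeg w') + 2)"
        unfolding ij(1) W2_neg_solve
        using 3 4 5 by (intro Mixed_add[OF Mixed_diff[OF Mixed_add[OF Mixed_diff[OF 1 2]]]] Mixed_sum Mixed_scale)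
      then show ?thesis
        unfolding eq by (rule Mixed_monoD) (use d in simp)
    qed
  qed
  then show ?case
    unfolding Filt_def by (intro VS.span_minimal) auto
qed

section \<open>The kernel\<close>

definition Mixed_top :: "nat \<Rightarrow> nat \<Rightarrow> 'v set" where
  "Mixed_top p c = VS.span {v. \<exists>q r. mixed_word q r v \<and> (q < p \<or> q = p \<and> r \<le> c)}"

lemma subspace_Mixed_top [simp, intro]: "VS.subspace (Mixed_top p c)"
  by (simp add: Mixed_top_def)

lemma Filt_Mixed_top: "Filt \<bb> p \<subseteq> Mixed_top p c"
  using Filt_subset_Mixed[of p] unfolding Mixed_def Mixed_top_def
  by (rule order_trans) (rule VS.span_mono, auto)

lemma mixed_word_count: "mixed_word p r v \<Longrightarrow> r \<le> p"
  by (induction rule: mixed_word.induct) auto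

text \<open>Subtracting \<open>Suc c\<close> from the Euler operator annihilates, modulo lower
  degree, the words with exactly \<open>Suc c\<close> letters and preserves the others. Membership
  in \<open>VB\<close> is carried along because \<open>d0\<close> is linear only there.\<close>

lemma contr_d0_Mixed_top:
  assumes "y \<in> Mixed_top p (Suc c)"
  shows "y \<in> VB \<and> contr (d0 y) - smult V (of_nat (Suc c)) y \<in> Mixed_top p c"
  using assms unfolding Mixed_top_def[of p "Suc c"]
proof (induction rule: VS.span_induct_alt)
  case base
  show ?case
    by (simp add: d0_zero VS.subspace_0[OF subspace_VB] VS.subspace_0)
next
  case (step a x y)
  let ?f = "\<lambda>y. contr (d0 y) - smult V (of_nat (Suc c)) y"
  from step obtain q r where x: "mixed_word q r x" "q < p \<or> q = p \<and> r \<le> Suc c"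
    by auto
  have 1: "contr (d0 x) - smult V (of_nat r) x \<in> Mixed_top p c"
    by (rule subsetD[OF Filt_Mixed_top Filt_monoD[OF contr_d0_mixed_word[OF x(1)]]]) (use x(2) in auto)
  \<comment> \<open>The coefficient vanishes exactly on the words with \<open>Suc c\<close> letters,
    the only ones in question that could lie outside \<open>Mixed_top p c\<close>.\<close>
  have 2: "smult V (of_nat r - of_nat (Suc c)) x \<in> Mixed_top p c"
  proof (cases "q = p \<and> r = Suc c")
    case True
    then show ?thesis by (simp add: VS.subspace_0)
  next
    case False
    then have "q < p \<or> q = p \<and> r \<le> c" using x(2) by auto
    then have "x \<in> Mixed_top p c"
      unfolding Mixed_top_def using x(1) by (intro VS.span_base) auto
    then show ?thesis by (rule VS.subspace_scale[OF subspace_Mixed_top])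
  qed
  have "?f x = (contr (d0 x) - smult V (of_nat r) x) + smult V (of_nat r - of_nat (Suc c)) x"
    by (simp only: VS.scale_left_diff_distrib) simp
  also have "\<dots> \<in> Mixed_top p c"
    using 1 2 by (rule VS.subspace_add[OF subspace_Mixed_top])
  finally have fx: "?f x \<in> Mixed_top p c" .
  have xVB: "x \<in> VB" using x(1) by (rule mixed_word_VB)
  have "?f (smult V a x + y) = smult V a (?f x) + ?f y"
    using xVB step.IH
    by (simp add: d0_add d0_scale VS.subspace_scale[OF subspace_VB] contr_add contr_scale
        VS.scale_right_diff_distrib VS.scale_right_distrib mult.commute del: of_nat_Suc)
  also have "\<dots> \<in> Mixed_top p c"
    using fx step.IH by (intro VS.subspace_add VS.subspace_scale subspace_Mixed_top) auto
  finally show ?case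
    using xVB step.IH by (auto intro: VS.subspace_add VS.subspace_scale subspace_VB)
qed

text \<open>On the kernel the contraction term is 0, so only \<open>Suc c\<close> times the vector
  is left, and this integer is invertible.\<close>

lemma ker_Mixed_top_step:
  assumes "y \<in> Mixed_top p (Suc c)" "d0 y = 0"
  shows "y \<in> Mixed_top p c"
proof -
  have "- smult V (of_nat (Suc c)) y \<in> Mixed_top p c"
    using contr_d0_Mixed_top[OF assms(1)] assms(2) by simp
  then have "smult V (- inverse (of_nat (Suc c))) (- smult V (of_nat (Suc c)) y) \<in> Mixed_top p c"
    by (rule VS.subspace_scale[OF subspace_Mixed_top])
  then show ?thesis
    by (simp del: of_nat_Suc)
qed

lemma ker_Mixed_top: "y \<in> Mixed_top p c \<Longrightarrow> d0 y = 0 \<Longrightarrow> y \<in> Mixed_top p 0"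
  by (induction c) (use ker_Mixed_top_step in blast)+

section \<open>Identification of the kernel with the span of the generator words\<close>

abbreviation "gens \<equiv> W1_set \<union> W2_set"

definition gen_words :: "'v set" where
  "gen_words = {creation_vec V l |l. \<forall>(a, s)\<in>set l. a \<in> gens \<and> 1 \<le> s}"

lemma mixed_word_gen_words: "v \<in> gen_words \<longleftrightarrow> (\<exists>p. mixed_word p 0 v)"
proof
  assume "v \<in> gen_words"
  then obtain l where l: "v = creation_vec V l" "\<forall>(a, s)\<in>set l. a \<in> gens \<and> 1 \<le> s"
    by (auto simp: gen_words_def)
  have "\<exists>p. mixed_word p 0 (creation_vec V l)"
    using l(2)
  proof (induction l)
    case Nil
    then show ?case using mixed_word.vac by (auto simp: creation_vec_def)
  next
    case (Cons b l)
    then obtain a s p where "b = (a, s)" "a \<in> gens" "1 \<le> s" "mixed_word p 0 (creation_vec V l)"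
      by (cases b) auto
    then show ?case
      using mixed_word.W1[of a s p 0] mixed_word.W2[of a s p 0] by (fastforce simp: creation_vec_def)
  qed
  then show "\<exists>p. mixed_word p 0 v" using l(1) by simp
next
  have Cons: "nprod V a (- int s) v \<in> gen_words" if "a \<in> gens" "1 \<le> s" "v \<in> gen_words" for a s v
  proof -
    obtain l where "v = creation_vec V l" "\<forall>(a, s)\<in>set l. a \<in> gens \<and> 1 \<le> s"
      using \<open>v \<in> gen_words\<close> by (auto simp: gen_words_def)
    then have "nprod V a (- int s) v = creation_vec V ((a, s) # l)"
      "\<forall>(a, s)\<in>set ((a, s) # l). a \<in> gens \<and> 1 \<le> s"
      using that by (auto simp: creation_vec_def)
    then show ?thesis
      unfolding gen_words_def by blast
  qed
  have nil: "vac V \<in> gen_words"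
    unfolding gen_words_def creation_vec_def by (auto intro!: exI[of _ "[]"])
  have "mixed_word p r v \<Longrightarrow> r = 0 \<Longrightarrow> v \<in> gen_words" for p r v
    by (induction rule: mixed_word.induct) (auto intro!: Cons nil)
  then show "\<exists>p. mixed_word p 0 v \<Longrightarrow> v \<in> gen_words" by blast
qed

lemma gen_words_ker: "v \<in> VS.span gen_words \<Longrightarrow> v \<in> VB \<and> d0 v = 0"
proof (induction rule: VS.span_induct_alt)
  case base
  show ?case by (simp add: d0_zero VS.subspace_0[OF subspace_VB])
next
  case (step c x y)
  have "mixed_word p r v \<Longrightarrow> r = 0 \<Longrightarrow> d0 v = 0" for p r v
    by (induction rule: mixed_word.induct) (auto simp: d0_vac d0_W1_mode d0_W2_mode mixed_word_VB)
  moreover obtain p where "mixed_word p 0 x"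
    using step by (auto simp: mixed_word_gen_words)
  ultimately have "d0 x = 0" "x \<in> VB"
    using mixed_word_VB by blast+
  then show ?case
    using step.IH by (simp add: d0_add d0_scale VS.subspace_scale[OF subspace_VB] VS.subspace_add[OF subspace_VB])
qed

text \<open>Once the leading part has no letters \<open>E i j\<close>, it is itself in the kernel;
  so is then the remainder, to which the induction hypothesis applies.\<close>

lemma ker_Filt: "y \<in> Filt \<bb> p \<Longrightarrow> d0 y = 0 \<Longrightarrow> y \<in> VS.span gen_words"
proof (induction p arbitrary: y)
  case 0
  then show ?case by (simp add: Filt_def VS.span_zero)
next
  case (Suc p)
  \<comment> \<open>A word of degree p has at most p letters, so the removal of letters can start at
    \<open>c = p\<close>.\<close>
  have "Mixed (Suc p) \<subseteq> Mixed_top p p"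
    unfolding Mixed_def Mixed_top_def using mixed_word_count by (intro VS.span_mono) fastforce
  then have "y \<in> Mixed_top p 0"
    using Suc.prems Filt_subset_Mixed ker_Mixed_top by blast
  then have "y \<in> VS.span ({v. mixed_word p 0 v} \<union> {v. \<exists>q r. q < p \<and> mixed_word q r v})"
    unfolding Mixed_top_def by (rule subsetD[OF VS.span_mono, rotated]) auto
  then obtain y0 y1 where y: "y = y0 + y1" "y0 \<in> VS.span {v. mixed_word p 0 v}"
      "y1 \<in> VS.span {v. \<exists>q r. q < p \<and> mixed_word q r v}"
    unfolding VS.span_Un by auto
  have y0: "y0 \<in> VS.span gen_words"
    using y(2) by (rule subsetD[OF VS.span_mono, rotated]) (auto simp: mixed_word_gen_words)
  have "{v. \<exists>q r. q < p \<and> mixed_word q r v} \<subseteq> Filt \<bb> p"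
  proof clarify
    fix v q r assume "q < p" "mixed_word q r v"
    then show "v \<in> Filt \<bb> p"
      by (intro Filt_monoD[OF mixed_word_Filt]) auto
  qed
  then have y1: "y1 \<in> Filt \<bb> p"
    using y(3) VS.span_minimal[OF _ subspace_Filt] by blast
  have "d0 y1 = 0"
    using gen_words_ker[OF y0] Filt_b_VB[OF y1] Suc.prems y(1) by (simp add: d0_add)
  then show ?case
    using Suc.IH[OF y1] y0 y(1) VS.span_add by blast
qed

lemma W_algebra_eq_span: "W_algebra m n V \<iota> d0 = VS.span gen_words"
proof
  show "VS.span gen_words \<subseteq> W_algebra m n V \<iota> d0"
    using gen_words_ker by (auto simp: W_algebra_def)
  show "W_algebra m n V \<iota> d0 \<subseteq> VS.span gen_words"
  proof
    fix y assume "y \<in> W_algebra m n V \<iota> d0"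
    then have "y \<in> VS.span (word ` neg_words \<bb>)" "d0 y = 0"
      by (auto simp: W_algebra_def Vb_def)
    \<comment> \<open>Each vector is a finite combination of words and so lies in some filtration
      step.\<close>
    then show "y \<in> VS.span gen_words"
      using ker_Filt by (auto elim: Filt_exhaust)
  qed
qed

lemma gens_subset: "gens \<subseteq> W_algebra m n V \<iota> d0"
  using d0_W1 d0_W2 W1_VB W2_VB by (auto simp: W_algebra_def)

end

theorem theorem3p7:
  fixes m n :: nat and k \<alpha>1 \<alpha>2 :: complex
    and V :: "('v::ab_group_add) vertex_data" and \<iota> :: "gen \<Rightarrow> 'v" and d0 :: "'v \<Rightarrow> 'v"
  assumes "m \<ge> n" and "n \<ge> 1"
    and "\<alpha>1 = k + of_nat n" and "\<alpha>2 = k + of_nat m"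
    and "universal_affine V (a_basis m n) gen_odd a_bracket (kappa m n \<alpha>1 \<alpha>2) \<iota>"
    and "is_d0 m n \<alpha>2 V \<iota> d0"
  shows "strongly_generates V (W_algebra m n V \<iota> d0)
    ({W1 m n V \<iota> i j |i j. (1 \<le> i \<and> i \<le> m - n \<and> 1 \<le> j \<and> j \<le> m) \<or>
                          (m - n < i \<and> i \<le> m \<and> m - n < j \<and> j \<le> m)}
     \<union> {W2 m n \<alpha>2 V \<iota> i j |i j. m - n < i \<and> i \<le> m \<and> 1 \<le> j \<and> j \<le> m})"
proof -
  interpret gl_w_algebra m n \<alpha>1 \<alpha>2 V \<iota> d0
    by (rule gl_w_algebra.intro) (use assms in auto)
  show ?thesis
    using gens_subset W_algebra_eq_span
    unfolding strongly_generates_def gen_words_def W1_set_def W2_set_def by blast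
qed

end
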